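(* Let $d\ge 2$, let $(\xi_{\mathbf u})_{\mathbf u\in\mathbb{Z}^d}$ be a strictly stationary real-valued random field on the canonical space $\mathbb{R}^{\mathbb{Z}^d}$, with filtration $\mathcal{F}_{\mathbf u}=\sigma(\xi_{\mathbf j}:\mathbf j\le\mathbf u)$, and let $X_{\mathbf m}=f((\xi_{\mathbf j})_{\mathbf j\le\mathbf m})$ be the associated stationary random field, with $X_{\mathbf 0}$ centered and square integrable. Assume that the filtration is commuting, i.e. $E_{\mathbf u}E_{\mathbf a}(X)=E_{\mathbf u\wedge\mathbf a}(X)$ for all integrable $X$ and all $\mathbf u,\mathbf a\in\mathbb{Z}^d$. Let $S_{\mathbf n}=\sum_{\mathbf u=\mathbf 1}^{\mathbf n}X_{\mathbf u}$. The following statements are equivalent: (a) The random field $(X_{\mathbf n})_{\mathbf n\in\mathbb{Z}^d}$ admits a martingale approximation. (b) There is a martingale differences field $(D_{\mathbf m})_{\mathbf m\in\mathbb{Z}^d}$ such that, as $\min_{1\le i\le d}n_i\to\infty$, $$\frac{1}{|\mathbf n|}\|S_{\mathbf n}\|^{2}\to E(D_{\mathbf 1}^{2})\quad\text{and}\quad \frac{1}{|\mathbf n|}\sum_{\mathbf j=\mathbf 1}^{\mathbf n}\|\mathcal{P}_{\mathbf 1}(S_{\mathbf j})-D_{\mathbf 1}\|^{2}\to 0.$$ (c) There is a martingale differences field $(D_{\mathbf m})_{\mathbf m\in\mathbb{Z}^d}$ such that, as $\min_{1\le i\le d}n_i\to\infty$, $$\frac{1}{|\mathbf n|}\sum_{\mathbf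 j=\mathbf 1}^{\mathbf n}\|\mathcal{P}_{\mathbf 1}(S_{\mathbf j})-D_{\mathbf 1}\|^{2}\to 0,$$ and for all $j$, $1\le j\le d$, $$\frac{1}{|\mathbf n|}\|E_{\mathbf n_j}(S_{\mathbf n})\|^{2}\to 0\quad\text{as }\min_{1\le i\le d}n_i\to\infty,$$ where $\mathbf n_j\in\mathbb{Z}^d$ has $j$-th coordinate $0$ and its other coordinates equal to those of $\mathbf n$. (d) There is a square integrable random variable $D_{\mathbf 1}$ such that, as $\min_{1\le i\le d}n_i\to\infty$, $$\frac{1}{|\mathbf n|}\sum_{\mathbf j=\mathbf 1}^{\mathbf n}\mathcal{P}_{\mathbf 1}(S_{\mathbf j})\ \text{ converges in }L^2\text{ to }D_{\mathbf 1}\quad\text{and}\quad \frac{1}{|\mathbf n|}\|S_{\mathbf n}\|^{2}\to E(D_{\mathbf 1}^{2}).$$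
   Context: Notation: $\mathbf 0=(0,\dots,0)$, $\mathbf 1=(1,\dots,1)$; $\mathbf j\le\mathbf u$ and $\mathbf u\wedge\mathbf a$ (minimum) are taken coordinate-wise; for $\mathbf n=(n_1,\dots,n_d)$ with positive coordinates, $\sum_{\mathbf u=\mathbf 1}^{\mathbf n}$ is the sum over all $\mathbf u\in\mathbb{Z}^d$ with $1\le u_i\le n_i$ for every $i$, and $|\mathbf n|=n_1\cdots n_d$; $\|\cdot\|$ is the $L^2$ norm; $E_{\mathbf a}(X)=E(X|\mathcal{F}_{\mathbf a})$. Limits as $\min_i n_i\to\infty$ place no other restriction on the $n_i$. Setting: $(\xi_{\mathbf u})$ are the coordinate maps on $\mathbb{R}^{\mathbb{Z}^d}$, with the $\sigma$-field generated by cylinders and a shift-invariant probability measure. For a measurable $g$, $Y_{\mathbf m}=g((\xi_{\mathbf j})_{\mathbf j\le\mathbf m})$ means $Y_{\mathbf m}=g\big((\xi_{\mathbf m+\mathbf i})_{\mathbf i\le\mathbf 0}\big)$, the same $g$ for all $\mathbf m$; equivalently $Y_{\mathbf m}=Y_{\mathbf 0}\circ T_1^{m_1}\circ\cdots\circ T_d^{m_d}$, with $T_i$ the shift by one in the $i$-th coordinate, $T_i((x_{\mathbf v})_{\mathbf v})=(x_{\mathbf v+\mathbf e_i})_{\mathbf v}$, where $\mathbf e_i$ is the $i$-th unit vector. The field is $X_{\mathbf m}=f((\xi_{\mathbf j})_{\mathbf j\le\mathbf m})$ with $f$ measurable, $E(X_{\mathbf 0})=0$, $E(X_{\mathbf 0}^2)<\infty$.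 Projection operator: for $\mathbf u\in\mathbb{Z}^d$, $\mathcal{P}_{\mathbf u}=P_{1}\circ P_{2}\circ\cdots\circ P_{d}$, where $P_{j}(Y)=E(Y|\mathcal{F}_{\mathbf u})-E(Y|\mathcal{F}_{\mathbf u-\mathbf e_j})$. Martingale differences field: a field $D_{\mathbf m}=g((\xi_{\mathbf j})_{\mathbf j\le\mathbf m})$, with $g$ measurable and $D_{\mathbf m}$ integrable, such that $E_{\mathbf a}(D_{\mathbf m})=0$ whenever at least one coordinate of $\mathbf a$ is strictly smaller than the corresponding coordinate of $\mathbf m$. Martingale approximation: $(X_{\mathbf n})$ admits a martingale approximation if there is a martingale differences field $(D_{\mathbf m})$ such that, with $M_{\mathbf n}=\sum_{\mathbf u=\mathbf 1}^{\mathbf n}D_{\mathbf u}$, $\frac{1}{|\mathbf n|}\|S_{\mathbf n}-M_{\mathbf n}\|^{2}\to 0$ as $\min_{1\le i\le d}n_i\to\infty$. *)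

theory Defs
  imports "HOL-Probability.Probability"
begin

text \<open>
  The lattice \<open>\<int>\<^sup>d\<close> is the type \<open>int ^ 'd\<close>, so that \<open>d = CARD('d)\<close>, with the library's
  coordinate-wise \<open>\<le>\<close>; \<open>axis i 1\<close> is the i-th unit vector. The index type \<open>'d\<close> is linearly
  ordered so that the composition of the operators \<open>P\<^sub>1, \<dots>, P\<^sub>d\<close> can be taken in this order.
  The coordinate maps \<open>\<xi>\<^sub>j\<close> are \<open>\<lambda>\<omega>. \<omega> j\<close>.
\<close>

type_synonym 'd config = "int ^ 'd \<Rightarrow> real"

definition cylinder_algebra :: "('d::finite) config measure" where
  "cylinder_algebra = (\<Pi>\<^sub>M j\<in>UNIV. borel)"

definition shift_map :: "'d \<Rightarrow> ('d::finite) config \<Rightarrow> 'd config" where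
  "shift_map i \<omega> = (\<lambda>v. \<omega> (v + axis i 1))"

definition shift_invariant :: "('d::finite) config measure \<Rightarrow> bool" where
  "shift_invariant M \<longleftrightarrow> (\<forall>i. distr M M (shift_map i) = M)"

definition past_sigma :: "int ^ 'd \<Rightarrow> ('d::finite) config measure" where
  "past_sigma u = sigma UNIV {(\<lambda>\<omega>. \<omega> j) -` B | j B. j \<le> u \<and> B \<in> sets borel}"

abbreviation cond_exp :: "('d::finite) config measure \<Rightarrow> int ^ 'd \<Rightarrow> ('d config \<Rightarrow> real) \<Rightarrow> 'd config \<Rightarrow> real"
  where "cond_exp M u \<equiv> real_cond_exp M (past_sigma u)"

definition commuting :: "('d::finite) config measure \<Rightarrow> bool" where
  "commuting M \<longleftrightarrow> (\<forall>Y u a. integrable M Y \<longrightarrow>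
     (AE \<omega> in M. cond_exp M u (cond_exp M a Y) \<omega> = cond_exp M (\<chi> i. min (u $ i) (a $ i)) Y \<omega>))"

text \<open>Measurable functions of the past \<open>(\<xi>\<^sub>j)\<^sub>j\<^sub>\<le>\<^sub>0\<close>, and the fields \<open>g ((\<xi>\<^sub>m\<^sub>+\<^sub>i)\<^sub>i\<^sub>\<le>\<^sub>0)\<close> they generate.\<close>

definition past_measurable :: "(('d::finite) config \<Rightarrow> real) set" where
  "past_measurable = borel_measurable (\<Pi>\<^sub>M i\<in>{..0}. borel)"

definition past_field :: "(('d::finite) config \<Rightarrow> real) \<Rightarrow> int ^ 'd \<Rightarrow> 'd config \<Rightarrow> real" where
  "past_field g m \<omega> = g (\<lambda>i\<in>{..0}. \<omega> (m + i))"

definition rect_sum :: "(int ^ 'd \<Rightarrow> ('d::finite) config \<Rightarrow> real) \<Rightarrow> int ^ 'd \<Rightarrow> 'd config \<Rightarrow> real" where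
  "rect_sum X n \<omega> = (\<Sum>u\<in>{1..n}. X u \<omega>)"

definition vol :: "int ^ ('d::finite) \<Rightarrow> real" where
  "vol n = real_of_int (\<Prod>i\<in>UNIV. n $ i)"

text \<open>
  The squared \<open>L\<^sup>2\<close> norm \<open>\<parallel>Y\<parallel>\<^sup>2 = E(Y\<^sup>2)\<close> takes values in \<^typ>\<open>ennreal\<close>: martingale differences
  are only assumed integrable, and a Bochner integral would assign the value 0 to \<open>E(Y\<^sup>2)\<close> when
  \<open>Y\<close> is not square integrable.
\<close>

definition norm2_sq :: "'a measure \<Rightarrow> ('a \<Rightarrow> real) \<Rightarrow> ennreal" where
  "norm2_sq M Y = (\<integral>\<^sup>+ \<omega>. ennreal ((Y \<omega>)\<^sup>2) \<partial>M)"

text \<open>The filter of \<open>min\<^sub>i n\<^sub>i \<rightarrow> \<infinity>\<close>.\<close>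

definition min_at_top :: "(int ^ ('d::finite)) filter" where
  "min_at_top = filtercomap (\<lambda>n. Min (range (\<lambda>i. n $ i))) at_top"

definition proj_step ::
    "('d::finite) config measure \<Rightarrow> int ^ 'd \<Rightarrow> 'd \<Rightarrow> ('d config \<Rightarrow> real) \<Rightarrow> 'd config \<Rightarrow> real" where
  "proj_step M u j Y = (\<lambda>\<omega>. cond_exp M u Y \<omega> - cond_exp M (u - axis j 1) Y \<omega>)"

text \<open>\<open>P\<^sub>1 (P\<^sub>2 (\<dots> (P\<^sub>d Y)))\<close>\<close>

definition proj ::
    "('d::{finite,linorder}) config measure \<Rightarrow> (int, 'd) vec \<Rightarrow> ('d config \<Rightarrow> real) \<Rightarrow> 'd config \<Rightarrow> real" where
  "proj M u Y = foldr (proj_step M u) (sorted_list_of_set UNIV) Y"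

definition martingale_differences ::
    "('d::finite) config measure \<Rightarrow> (int ^ 'd \<Rightarrow> 'd config \<Rightarrow> real) \<Rightarrow> bool" where
  "martingale_differences M D \<longleftrightarrow>
     (\<exists>g\<in>past_measurable. D = past_field g) \<and>
     (\<forall>m. integrable M (D m)) \<and>
     (\<forall>a m. (\<exists>i. a $ i < m $ i) \<longrightarrow> (AE \<omega> in M. cond_exp M a (D m) \<omega> = 0))"

definition martingale_approximation ::
    "('d::finite) config measure \<Rightarrow> (int ^ 'd \<Rightarrow> 'd config \<Rightarrow> real) \<Rightarrow> bool" where
  "martingale_approximation M X \<longleftrightarrow>
     (\<exists>D. martingale_differences M D \<and>
        ((\<lambda>n. norm2_sq M (\<lambda>\<omega>. rect_sum X n \<omega> - rect_sum D n \<omega>) / ennreal (vol n))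
           \<longlongrightarrow> 0) min_at_top)"

end

theory Submission
  imports Defs
begin

text \<open>
  Because the conditional expectations commute, \<open>P\<^sub>u S\<^sub>n\<close> is a martingale difference at \<open>u\<close>, and
  pairing it with such a difference gives the same value as pairing \<open>S\<^sub>n\<close> itself. Put
  \<open>R\<^sub>n = \<Sum> P\<^sub>u S\<^sub>n\<close> over \<open>1 \<le> u \<le> n\<close>. Then \<open>S\<^sub>n - R\<^sub>n\<close> is orthogonal to every martingale
  difference at a point of the box, and by stationarity \<open>P\<^sub>u S\<^sub>n\<close> is a shift of \<open>P\<^sub>1 S\<^sub>j\<close> with
  \<open>j = n - u + 1\<close>. For a martingale differences field \<open>D\<close> with partial sums \<open>M\<^sub>n\<close>, Pythagoras gives
  \<open>\<parallel>S\<^sub>n - M\<^sub>n\<parallel>\<^sup>2 = r + q(D)\<close> and \<open>\<parallel>S\<^sub>n\<parallel>\<^sup>2 = r + q(0)\<close>, where \<open>r = \<parallel>S\<^sub>n - R\<^sub>n\<parallel>\<^sup>2\<close> and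
  \<open>q(D)\<close> is the sum of \<open>\<parallel>P\<^sub>1 S\<^sub>j - D\<^sub>1\<parallel>\<^sup>2\<close> over \<open>1 \<le> j \<le> n\<close>. Telescoping expresses \<open>S\<^sub>n - R\<^sub>n\<close> by the
  conditional expectations of \<open>S\<^sub>n\<close> at the corners of the box where some coordinates are \<open>0\<close>, so that
  \<open>r\<close> is comparable to the sum of the \<open>\<parallel>E\<^bsub>n\<^sub>j\<^esub> S\<^sub>n\<parallel>\<^sup>2\<close>. Each of the four statements is therefore
  equivalent to \<open>r / |n| \<rightarrow> 0\<close> and \<open>q(D) / |n| \<rightarrow> 0\<close> for some \<open>D\<close>; for the last one expand the squares
  in \<open>q(D)\<close> and bound \<open>q(0)\<close> by \<open>\<parallel>S\<^sub>n\<parallel>\<^sup>2\<close>.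
\<close>

subsection \<open>Boxes in the integer lattice\<close>

definition vmin :: "int ^ 'd \<Rightarrow> int ^ 'd \<Rightarrow> int ^ ('d::finite)" where
  "vmin a b = (\<chi> i. min (a $ i) (b $ i))"

definition indvec :: "'d set \<Rightarrow> int ^ ('d::finite)" where
  "indvec J = (\<chi> i. if i \<in> J then 1 else 0)"

definition zero_on :: "'d set \<Rightarrow> int ^ 'd \<Rightarrow> int ^ ('d::finite)" where
  "zero_on J n = (\<chi> i. if i \<in> J then 0 else n $ i)"

lemma vmin_nth [simp]: "vmin a b $ i = min (a $ i) (b $ i)"
  by (simp add: vmin_def)

lemma indvec_nth [simp]: "indvec J $ i = (if i \<in> J then 1 else 0)"
  by (simp add: indvec_def)

lemma zero_on_nth [simp]: "zero_on J n $ i = (if i \<in> J then 0 else n $ i)"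
  by (simp add: zero_on_def)

lemma vmin_eq_left: "a \<le> b \<Longrightarrow> vmin a b = a"
  by (simp add: vec_eq_iff less_eq_vec_def)

lemma vmin_eq_right: "b \<le> a \<Longrightarrow> vmin a b = b"
  by (simp add: vec_eq_iff less_eq_vec_def min_def) (meson order_antisym)

lemma vmin_commute: "vmin a b = vmin b a"
  by (simp add: vec_eq_iff min.commute)

lemma indvec_empty [simp]: "indvec {} = 0"
  by (simp add: vec_eq_iff)

text \<open>Choosing one summand in each coordinate amounts to choosing a point of the box, so
  multiplying out the product of sums gives a sum over choice functions, identified with
  vectors.\<close>

lemma sum_prod_box:
  fixes f :: "'d::finite \<Rightarrow> int \<Rightarrow> real"
  shows "(\<Sum>u\<in>{a..b}. \<Prod>i\<in>UNIV. f i (u $ i)) = (\<Prod>i\<in>UNIV. \<Sum>t\<in>{a $ i..b $ i}. f i t)"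
proof -
  have "(\<Prod>i\<in>UNIV. \<Sum>t\<in>{a $ i..b $ i}. f i t) = (\<Sum>g\<in>PiE UNIV (\<lambda>i. {a $ i..b $ i}). \<Prod>i\<in>UNIV. f i (g i))"
    by (rule prod_sum_PiE) auto
  also have "\<dots> = (\<Sum>u\<in>{a..b}. \<Prod>i\<in>UNIV. f i (u $ i))"
    by (rule sum.reindex_bij_witness[of _ "\<lambda>u. vec_nth u" "\<lambda>g. vec_lambda g"])
       (auto simp: PiE_iff less_eq_vec_def)
  finally show ?thesis by simp
qed

lemma finite_box [simp]: "finite {a..b :: int ^ ('d::finite)}"
proof -
  have "finite (PiE UNIV (\<lambda>i. {a $ i..b $ i}))"
    by (intro finite_PiE) auto
  moreover have "{a..b} \<subseteq> vec_lambda ` PiE UNIV (\<lambda>i. {a $ i..b $ i})"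
  proof
    fix u assume "u \<in> {a..b}"
    then show "u \<in> vec_lambda ` PiE UNIV (\<lambda>i. {a $ i..b $ i})"
      by (intro image_eqI[of _ _ "vec_nth u"]) (auto simp: PiE_iff less_eq_vec_def)
  qed
  ultimately show ?thesis by (meson finite_imageI finite_subset)
qed

lemma card_box:
  assumes "1 \<le> n"
  shows "real (card {1..n}) = vol n"
proof -
  have n: "1 \<le> n $ i" for i using assms by (simp add: less_eq_vec_def)
  have "real (card {1..n}) = (\<Prod>i\<in>UNIV. \<Sum>t\<in>{1..n $ i}. 1)"
    using sum_prod_box[of "\<lambda>_ _. 1" 1 n] by simp
  also have "\<dots> = vol n"
    unfolding vol_def of_int_prod using n
    by (intro prod.cong refl) (simp add: order_trans[OF zero_le_one n])
  finally show ?thesis .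
qed

lemma vol_pos: "1 \<le> n \<Longrightarrow> vol n > 0"
  by (auto simp: vol_def less_eq_vec_def intro!: prod_pos) (metis less_le_trans zero_less_one)

lemma sum_telescope_int:
  fixes g :: "int \<Rightarrow> real"
  assumes "0 \<le> m"
  shows "(\<Sum>t\<in>{1..m}. g t - g (t - 1)) = g m - g 0"
  using assms
proof (induction m rule: int_ge_induct)
  case (step m)
  have "{1..m + 1} = insert (m + 1) {1..m}" using step by auto
  with step show ?case by simp
qed simp

text \<open>When the product is multiplied out, \<open>J\<close> is the set of coordinates in which
  \<open>- g i\<close> is taken.\<close>

lemma sum_alternating_prod:
  fixes f g :: "'d::finite \<Rightarrow> real"
  shows "(\<Sum>J\<in>UNIV. (-1) ^ card J * (\<Prod>i\<in>UNIV. if i \<in> J then g i else f i)) = (\<Prod>i\<in>UNIV. f i - g i)"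
  by (subst prod_diff_conv_sum) (simp_all add: prod.If_cases Compl_eq_Diff_UNIV mult.assoc)

text \<open>By linearity it suffices to treat indicator functions of single points, which are products
  over the coordinates.\<close>

lemma sum_box_telescope:
  fixes F :: "int ^ ('d::finite) \<Rightarrow> real"
  assumes "1 \<le> n"
  shows "(\<Sum>u\<in>{1..n}. \<Sum>J\<in>UNIV. (-1) ^ card J * F (u - indvec J))
       = (\<Sum>J\<in>UNIV. (-1) ^ card J * F (zero_on J n))"
proof -
  define e :: "int ^ 'd \<Rightarrow> int ^ 'd \<Rightarrow> real" where "e w v = (\<Prod>i\<in>UNIV. of_bool (v $ i = w $ i))" for w v
  have e: "e w v = of_bool (w = v)" for w v
    unfolding e_def vec_eq_iff by (auto, metis)
  have n: "1 \<le> n $ i" for i using assms by (simp add: less_eq_vec_def)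
  \<comment> \<open>The box starts at 0 because the points \<open>u - indvec J\<close> and
    \<open>zero_on J n\<close>, at which \<open>F\<close> is evaluated, may have coordinates equal
    to 0.\<close>
  have F: "F v = (\<Sum>w\<in>{0..n}. F w * e w v)" if "v \<in> {0..n}" for v
    using that by (simp add: e if_distrib[of "\<lambda>x. _ * x"] of_bool_def cong: if_cong)
  have key: "(\<Sum>u\<in>{1..n}. \<Sum>J\<in>UNIV. (-1) ^ card J * e w (u - indvec J))
       = (\<Sum>J\<in>UNIV. (-1) ^ card J * e w (zero_on J n))" for w
  proof -
    have "(\<Sum>u\<in>{1..n}. \<Sum>J\<in>UNIV. (-1) ^ card J * e w (u - indvec J))
        = (\<Sum>u\<in>{1..n}. \<Prod>i\<in>UNIV. of_bool (u $ i = w $ i) - of_bool (u $ i - 1 = w $ i))"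
      unfolding sum_alternating_prod[symmetric] e_def
      by (intro sum.cong arg_cong2[where f="(*)"] prod.cong refl) auto
    \<comment> \<open>Once the sum factors over the coordinates, each factor is a one-dimensional
      telescoping sum.\<close>
    also have "\<dots> = (\<Prod>i\<in>UNIV. of_bool (n $ i = w $ i) - of_bool (0 = w $ i))"
      by (subst sum_prod_box, intro prod.cong refl)
         (use sum_telescope_int[of "n $ _" "\<lambda>t. of_bool (t = w $ _)"] order_trans[OF zero_le_one n] in simp)
    also have "\<dots> = (\<Sum>J\<in>UNIV. (-1) ^ card J * e w (zero_on J n))"
      unfolding sum_alternating_prod[symmetric] e_def
      by (intro sum.cong arg_cong2[where f="(*)"] prod.cong refl) auto
    finally show ?thesis .
  qed
  have "(\<Sum>u\<in>{1..n}. \<Sum>J\<in>UNIV. (-1) ^ card J * F (u - indvec J))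
      = (\<Sum>u\<in>{1..n}. \<Sum>J\<in>UNIV. \<Sum>w\<in>{0..n}. (-1) ^ card J * (F w * e w (u - indvec J)))"
  proof (intro sum.cong refl)
    fix u J assume u: "u \<in> {1..n}"
    then have "u - indvec J \<in> {0..n}"
      by (auto simp: less_eq_vec_def) (smt (verit))+
    then show "(-1) ^ card J * F (u - indvec J) = (\<Sum>w\<in>{0..n}. (-1) ^ card J * (F w * e w (u - indvec J)))"
      by (subst F) (auto simp: sum_distrib_left)
  qed
  also have "\<dots> = (\<Sum>u\<in>{1..n}. \<Sum>w\<in>{0..n}. \<Sum>J\<in>UNIV. (-1) ^ card J * (F w * e w (u - indvec J)))"
    by (intro sum.cong refl) (rule sum.swap)
  also have "\<dots> = (\<Sum>w\<in>{0..n}. \<Sum>u\<in>{1..n}. \<Sum>J\<in>UNIV. (-1) ^ card J * (F w * e w (u - indvec J)))"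
    by (rule sum.swap)
  also have "\<dots> = (\<Sum>w\<in>{0..n}. F w * (\<Sum>u\<in>{1..n}. \<Sum>J\<in>UNIV. (-1) ^ card J * e w (u - indvec J)))"
    by (simp add: sum_distrib_left mult.left_commute)
  also have "\<dots> = (\<Sum>w\<in>{0..n}. F w * (\<Sum>J\<in>UNIV. (-1) ^ card J * e w (zero_on J n)))"
    unfolding key ..
  also have "\<dots> = (\<Sum>J\<in>UNIV. \<Sum>w\<in>{0..n}. (-1) ^ card J * (F w * e w (zero_on J n)))"
    unfolding sum_distrib_left by (subst sum.swap) (simp add: mult_ac)
  also have "\<dots> = (\<Sum>J\<in>UNIV. (-1) ^ card J * F (zero_on J n))"
  proof (intro sum.cong refl)
    fix J :: "'d set"
    have "zero_on J n \<in> {0..n}"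
      using n by (auto simp: less_eq_vec_def intro: order_trans[OF _ n])
    then show "(\<Sum>w\<in>{0..n}. (-1) ^ card J * (F w * e w (zero_on J n))) = (-1) ^ card J * F (zero_on J n)"
      by (subst F[of "zero_on J n"]) (auto simp: sum_distrib_left)
  qed
  finally show ?thesis .
qed

text \<open>The summands for \<open>J\<close> and its symmetric difference with \<open>{i}\<close> cancel.\<close>

lemma sum_alternating_eq_0:
  fixes F :: "('d::finite) set \<Rightarrow> real"
  assumes "\<And>J. F (insert i J) = F (J - {i})"
  shows "(\<Sum>J\<in>UNIV. (-1) ^ card J * F J) = 0"
proof -
  define t where "t J = (if i \<in> J then J - {i} else insert i J)" for J
  have t: "t (t J) = J" for J
    by (auto simp: t_def)
  have F: "F (t J) = F J" for J
    using assms[of J] by (auto simp: t_def insert_absorb)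
  have c: "(-1::real) ^ card (t J) = - ((-1) ^ card J)" for J
  proof (cases "i \<in> J")
    case True
    then have "card J = Suc (card (t J))" unfolding t_def by (metis card.remove finite)
    then show ?thesis by (metis minus_minus power_Suc mult_minus1)
  qed (simp add: t_def)
  have "(\<Sum>J\<in>UNIV. (-1) ^ card J * F J) = (\<Sum>J\<in>UNIV. (-1) ^ card (t J) * F (t J))"
    by (rule sum.reindex_bij_witness[of _ t t]) (auto simp: t)
  also have "\<dots> = - (\<Sum>J\<in>UNIV. (-1) ^ card J * F J)"
    by (simp add: F c sum_negf)
  finally show ?thesis by simp
qed

subsection \<open>Shifts and the filtration\<close>

definition shift :: "int ^ 'd \<Rightarrow> ('d::finite) config \<Rightarrow> 'd config" where
  "shift v \<omega> = (\<lambda>w. \<omega> (w + v))"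

lemma shift_shift: "shift u (shift v \<omega>) = shift (u + v) \<omega>"
  by (simp add: shift_def ac_simps)

lemma shift_0 [simp]: "shift 0 = (\<lambda>\<omega>. \<omega>)"
  by (simp add: shift_def fun_eq_iff)

lemma past_field_add: "past_field g (m + v) \<omega> = past_field g m (shift v \<omega>)"
  by (simp add: past_field_def shift_def ac_simps)

lemma space_past_sigma [simp]: "space (past_sigma u) = UNIV"
  by (simp add: past_sigma_def space_measure_of_conv)

lemma sets_past_sigma:
  "sets (past_sigma u) = sigma_sets UNIV {(\<lambda>\<omega>. \<omega> j) -` B | j B. j \<le> u \<and> B \<in> sets borel}"
  by (simp add: past_sigma_def sets_measure_of_conv)

lemma measurable_coordinate_past [measurable (raw)]:
  assumes "j \<le> u" shows "(\<lambda>\<omega>. \<omega> j) \<in> borel_measurable (past_sigma u)"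
proof (rule measurableI)
  fix B :: "real set" assume "B \<in> sets borel"
  with assms show "(\<lambda>\<omega>. \<omega> j) -` B \<inter> space (past_sigma u) \<in> sets (past_sigma u)"
    unfolding sets_past_sigma by auto
qed simp

lemma measurable_past_sigmaI:
  fixes f :: "'b \<Rightarrow> ('d::finite) config"
  assumes "\<And>j. j \<le> u \<Longrightarrow> (\<lambda>x. f x j) \<in> borel_measurable N"
  shows "f \<in> measurable N (past_sigma u)"
  unfolding past_sigma_def
proof (rule measurable_measure_of)
  fix A :: "'d config set" assume "A \<in> {(\<lambda>\<omega>. \<omega> j) -` B | j B. j \<le> u \<and> B \<in> sets borel}"
  then obtain j B where A: "A = (\<lambda>\<omega>. \<omega> j) -` B" "j \<le> u" "B \<in> sets borel" by auto
  then have "f -` A \<inter> space N = (\<lambda>x. f x j) -` B \<inter> space N" by auto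
  then show "f -` A \<inter> space N \<in> sets N" using assms[OF A(2)] A(3) by (simp add: measurable_sets)
qed auto

lemma shift_measurable_past: "shift v \<in> measurable (past_sigma (u + v)) (past_sigma u)"
  unfolding shift_def
  by (rule measurable_past_sigmaI, rule measurable_coordinate_past) (simp add: less_eq_vec_def)

lemma past_field_measurable_past:
  assumes "g \<in> past_measurable"
  shows "past_field g m \<in> borel_measurable (past_sigma m)"
proof -
  have "(\<lambda>\<omega>. \<lambda>i\<in>{..0}. \<omega> (m + i)) \<in> measurable (past_sigma m) (\<Pi>\<^sub>M i\<in>{..0}. borel)"
    by (intro measurable_restrict measurable_coordinate_past) (simp add: less_eq_vec_def)
  with assms have "(\<lambda>\<omega>. g (\<lambda>i\<in>{..0}. \<omega> (m + i))) \<in> borel_measurable (past_sigma m)"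
    unfolding past_measurable_def by (rule measurable_compose[rotated])
  then show ?thesis unfolding past_field_def[abs_def] .
qed

text \<open>A Doob-Dynkin factorization: a function measurable for \<open>past_sigma u\<close> sees
  only the coordinates \<open>j <= u\<close>. \<open>cut\<close> sets the other coordinates to 0,
  and \<open>ext\<close> rebuilds the cut configuration from the past translated to the origin, so
  \<open>Z o ext\<close> is the required \<open>g\<close>.\<close>

lemma past_measurable_factor:
  assumes "Z \<in> borel_measurable (past_sigma u)"
  obtains g where "g \<in> past_measurable" "past_field g u = Z"
proof
  define ext :: "'a config \<Rightarrow> 'a config" where "ext x = (\<lambda>w. if w \<le> u then x (w - u) else 0)" for x
  define cut :: "'a config \<Rightarrow> 'a config" where "cut \<omega> = (\<lambda>w. if w \<le> u then \<omega> w else 0)" for \<omega>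
  have "ext \<in> measurable (\<Pi>\<^sub>M i\<in>{..0}. borel) (past_sigma u)"
    unfolding ext_def
    by (rule measurable_past_sigmaI) (auto simp: less_eq_vec_def)
  then show "(\<lambda>x. Z (ext x)) \<in> past_measurable"
    unfolding past_measurable_def using assms by (rule measurable_compose)
  \<comment> \<open>The generators do not see the erased coordinates, and invariance passes to
    complements and countable unions.\<close>
  have "cut -` A = A" if "A \<in> sets (past_sigma u)" for A
    using that unfolding sets_past_sigma
  proof induction
    case (Basic A)
    then show ?case by (auto simp: cut_def)
  next
    case (Union A)
    then show ?case by (auto simp: vimage_UN)
  qed (auto simp: vimage_Diff)
  \<comment> \<open>Invariance of the level set through a point says that \<open>Z\<close> takes the
    same value before and after \<open>cut\<close>.\<close>
  moreover have "Z -` {Z \<omega>} \<in> sets (past_sigma u)" for \<omega>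
    using measurable_sets[OF assms, of "{Z \<omega>}"] by simp
  ultimately have "cut -` (Z -` {Z \<omega>}) = Z -` {Z \<omega>}" for \<omega> by blast
  then have "Z (cut \<omega>) = Z \<omega>" for \<omega> by blast
  moreover have "ext (\<lambda>i\<in>{..0}. \<omega> (u + i)) = cut \<omega>" for \<omega>
    by (auto simp: ext_def cut_def fun_eq_iff less_eq_vec_def)
  ultimately show "past_field (\<lambda>x. Z (ext x)) u = Z"
    unfolding past_field_def by (intro HOL.ext) simp
qed

section \<open>Invariance of the measure and of the conditional expectations under all
  translations\<close>

locale commuting_field = prob_space M for M :: "('d::finite) config measure" +
  assumes sets_M: "sets M = sets cylinder_algebra"
    and shift_invariant: "shift_invariant M"
    and commuting: "commuting M"
begin

lemma space_M [simp]: "space M = UNIV"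
  using sets_eq_imp_space_eq[OF sets_M] by (simp add: cylinder_algebra_def space_PiM)

lemma measurable_coordinate: "(\<lambda>\<omega>. \<omega> j) \<in> borel_measurable M"
  by (subst measurable_cong_sets[OF sets_M refl]) (simp add: cylinder_algebra_def)

lemma measurable_MI:
  assumes "\<And>j. (\<lambda>x. f x j) \<in> borel_measurable N"
  shows "f \<in> measurable N M"
  by (subst measurable_cong_sets[OF refl sets_M])
     (auto simp: cylinder_algebra_def intro!: measurable_PiM_single' assms)

lemma subalgebra_past: "subalgebra M (past_sigma u)"
proof -
  have "(\<lambda>\<omega>. \<omega>) \<in> measurable M (past_sigma u)"
    by (rule measurable_past_sigmaI, rule measurable_coordinate)
  then show ?thesis by (auto simp: subalgebra_def measurable_def)
qed

lemma past_measurable_M: "f \<in> borel_measurable (past_sigma u) \<Longrightarrow> f \<in> borel_measurable M"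
  by (rule measurable_from_subalg[OF subalgebra_past])

sublocale past: sigma_finite_subalgebra M "past_sigma u" for u
  by (intro finite_measure_subalgebra_is_sigma_finite
      finite_measure_subalgebra.intro finite_measure_axioms finite_measure_subalgebra_axioms.intro subalgebra_past)

lemma shift_measurable [measurable]: "shift v \<in> measurable M M"
  unfolding shift_def by (rule measurable_MI, rule measurable_coordinate)

lemma distr_shift_uminus:
  assumes "distr M M (shift v) = M"
  shows "distr M M (shift (- v)) = M"
proof -
  have "distr M M (shift (- v)) = distr (distr M M (shift v)) M (shift (- v))"
    using assms by simp
  also have "\<dots> = distr M M (\<lambda>\<omega>. \<omega>)"
    by (subst distr_distr) (auto simp: comp_def shift_shift)
  finally show ?thesis by (simp add: distr_id)
qed

lemma distr_shift_add:
  assumes "distr M M (shift u) = M" "distr M M (shift v) = M"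
  shows "distr M M (shift (u + v)) = M"
proof -
  have "distr M M (shift (u + v)) = distr (distr M M (shift v)) M (shift u)"
    by (subst distr_distr) (auto simp: comp_def shift_shift)
  then show ?thesis using assms by simp
qed

text \<open>Invariance is assumed for unit shifts only. Iteration gives nonnegative multiples,
  inversion gives negative ones, and composing over the coordinates gives an arbitrary
  vector.\<close>

lemma distr_shift: "distr M M (shift v) = M"
proof -
  have 1: "distr M M (shift (axis i (int k))) = M" for i k
  proof (induction k)
    case 0
    have "axis i (int 0) = (0 :: int ^ 'd)" by (simp add: axis_def vec_eq_iff)
    then show ?case by (simp only: shift_0 distr_id)
  next
    case (Suc k)
    have "axis i (int (Suc k)) = axis i 1 + axis i (int k)"
      by (simp add: axis_def vec_eq_iff)
    moreover have "distr M M (shift (axis i 1)) = M"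
      using shift_invariant by (simp add: shift_invariant_def shift_map_def[abs_def] shift_def[abs_def])
    ultimately show ?case using Suc distr_shift_add by metis
  qed
  have 2: "distr M M (shift (axis i k)) = M" for i k
  proof (cases "k \<ge> 0")
    case True
    then show ?thesis using 1[of i "nat k"] by simp
  next
    case False
    have "axis i k = - axis i (int (nat (- k)))"
      using False by (simp add: axis_def vec_eq_iff)
    then show ?thesis using distr_shift_uminus[OF 1] by metis
  qed
  have 3: "distr M M (shift (\<Sum>i\<in>I. axis i (v $ i))) = M" if "finite I" for I
    using that
  proof (induction I)
    case empty
    then show ?case by (simp add: distr_id)
  next
    case (insert i I)
    then show ?case using distr_shift_add[OF 2] by simp
  qed
  have "(\<Sum>i\<in>UNIV. axis i (v $ i)) = v"
    by (simp add: vec_eq_iff axis_def)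
  with 3[of UNIV] show ?thesis by simp
qed

lemma integral_shift:
  fixes Y :: "'d config \<Rightarrow> real"
  assumes "Y \<in> borel_measurable M"
  shows "(\<integral>\<omega>. Y (shift v \<omega>) \<partial>M) = (\<integral>\<omega>. Y \<omega> \<partial>M)"
  using integral_distr[OF shift_measurable assms, of v] by (simp add: distr_shift)

lemma integrable_shift:
  fixes Y :: "'d config \<Rightarrow> real"
  assumes "integrable M Y"
  shows "integrable M (\<lambda>\<omega>. Y (shift v \<omega>))"
  using assms integrable_distr[OF shift_measurable, of v Y] by (simp add: distr_shift)

lemma AE_shift:
  assumes "AE \<omega> in M. P \<omega>"
  shows "AE \<omega> in M. P (shift v \<omega>)"
  using assms by (subst (asm) distr_shift[of v, symmetric]) (rule AE_distrD[OF shift_measurable])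

text \<open>The sets of \<open>past_sigma (u + v)\<close> are the preimages under
  \<open>shift v\<close> of the sets of \<open>past_sigma u\<close>, so the defining integral
  identity at \<open>u\<close> is transported by invariance.\<close>

lemma cond_exp_shift:
  assumes Y: "integrable M Y"
  shows "AE \<omega> in M. cond_exp M (u + v) (\<lambda>\<omega>. Y (shift v \<omega>)) \<omega> = cond_exp M u Y (shift v \<omega>)"
proof (rule past.real_cond_exp_charact)
  show "integrable M (\<lambda>\<omega>. Y (shift v \<omega>))" "integrable M (\<lambda>\<omega>. cond_exp M u Y (shift v \<omega>))"
    using Y by (auto intro!: integrable_shift past.real_cond_exp_int)
  show "(\<lambda>\<omega>. cond_exp M u Y (shift v \<omega>)) \<in> borel_measurable (past_sigma (u + v))"
    by (rule measurable_compose[OF shift_measurable_past borel_measurable_cond_exp])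
  fix A assume A: "A \<in> sets (past_sigma (u + v))"
  \<comment> \<open>\<open>B\<close> is the image of \<open>A\<close> under \<open>shift v\<close>,
    written as a preimage under the inverse shift to make its measurability evident.\<close>
  define B where "B = shift (- v) -` A"
  have B: "B \<in> sets (past_sigma u)"
    using measurable_sets[OF shift_measurable_past[of "- v" "u + v"] A] by (simp add: B_def)
  have BM [measurable]: "B \<in> sets M" using B subalgebra_past[of u] by (auto simp: subalgebra_def)
  have ind: "indicator A \<omega> = (indicator B (shift v \<omega>) :: real)" for \<omega>
    by (simp add: B_def indicator_def shift_shift)
  have Ym [measurable]: "Y \<in> borel_measurable M" using Y by simp
  have "(\<integral>\<omega>\<in>A. Y (shift v \<omega>) \<partial>M) = (\<integral>\<omega>\<in>B. Y \<omega> \<partial>M)"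
    unfolding set_lebesgue_integral_def ind
    by (subst integral_shift[of "\<lambda>\<omega>. indicator B \<omega> *\<^sub>R Y \<omega>"]) auto
  also have "\<dots> = (\<integral>\<omega>\<in>B. cond_exp M u Y \<omega> \<partial>M)"
    by (rule past.real_cond_exp_intA[OF Y B])
  also have "\<dots> = (\<integral>\<omega>\<in>A. cond_exp M u Y (shift v \<omega>) \<partial>M)"
    unfolding set_lebesgue_integral_def ind
    by (subst integral_shift[of "\<lambda>\<omega>. indicator B \<omega> *\<^sub>R cond_exp M u Y \<omega>"]) auto
  finally show "(\<integral>\<omega>\<in>A. Y (shift v \<omega>) \<partial>M) = (\<integral>\<omega>\<in>A. cond_exp M u Y (shift v \<omega>) \<partial>M)" .
qed

lemma cond_exp_cond_exp:
  "integrable M Y \<Longrightarrow> AE \<omega> in M. cond_exp M u (cond_exp M a Y) \<omega> = cond_exp M (vmin u a) Y \<omega>"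
  using commuting unfolding commuting_def vmin_def by blast

end

subsection \<open>Square integrable functions\<close>

text \<open>Measurability is required separately: it does not follow from integrability of the
  square.\<close>

definition sq_integrable :: "'a measure \<Rightarrow> ('a \<Rightarrow> real) \<Rightarrow> bool" where
  "sq_integrable M Y \<longleftrightarrow> Y \<in> borel_measurable M \<and> integrable M (\<lambda>\<omega>. (Y \<omega>)\<^sup>2)"

text \<open>Real-valued counterpart of \<open>norm2_sq\<close>, convenient for Hilbert space
  arithmetic. The two agree on square integrable functions; otherwise the Bochner integral may give
  the default value 0.\<close>

definition msq :: "'a measure \<Rightarrow> ('a \<Rightarrow> real) \<Rightarrow> real" where
  "msq M Y = (\<integral>\<omega>. (Y \<omega>)\<^sup>2 \<partial>M)"

lemma sq_integrable_measurable: "sq_integrable M Y \<Longrightarrow> Y \<in> borel_measurable M"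
  by (simp add: sq_integrable_def)

lemma sq_integrable_mult:
  assumes "sq_integrable M U" "sq_integrable M V"
  shows "integrable M (\<lambda>\<omega>. U \<omega> * V \<omega>)"
proof (rule Bochner_Integration.integrable_bound)
  show "integrable M (\<lambda>\<omega>. (U \<omega>)\<^sup>2 + (V \<omega>)\<^sup>2)"
    using assms by (simp add: sq_integrable_def)
  show "(\<lambda>\<omega>. U \<omega> * V \<omega>) \<in> borel_measurable M"
    using assms by (auto simp: sq_integrable_def)
  have "\<bar>x * y\<bar> \<le> x\<^sup>2 + y\<^sup>2" for x y :: real
    using sum_squares_bound[of "\<bar>x\<bar>" "\<bar>y\<bar>"] abs_ge_zero[of "x * y"]
    unfolding abs_mult mult.assoc power2_abs by linarith
  then show "AE \<omega> in M. norm (U \<omega> * V \<omega>) \<le> norm ((U \<omega>)\<^sup>2 + (V \<omega>)\<^sup>2)"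
    by simp
qed

lemma sq_integrable_cmult: "sq_integrable M U \<Longrightarrow> sq_integrable M (\<lambda>\<omega>. c * U \<omega>)"
  by (auto simp: sq_integrable_def power_mult_distrib)

lemma sq_integrable_add:
  assumes "sq_integrable M U" "sq_integrable M V"
  shows "sq_integrable M (\<lambda>\<omega>. U \<omega> + V \<omega>)"
proof -
  have "integrable M (\<lambda>\<omega>. (U \<omega>)\<^sup>2 + (V \<omega>)\<^sup>2 + 2 * (U \<omega> * V \<omega>))"
    using sq_integrable_mult[OF assms] assms by (simp add: sq_integrable_def)
  then show ?thesis
    using assms by (auto simp: sq_integrable_def power2_sum mult.assoc)
qed

lemma sq_integrable_diff:
  "sq_integrable M U \<Longrightarrow> sq_integrable M V \<Longrightarrow> sq_integrable M (\<lambda>\<omega>. U \<omega> - V \<omega>)"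
  using sq_integrable_add[of M U "\<lambda>\<omega>. (-1) * V \<omega>"] sq_integrable_cmult[of M V "-1"] by simp

lemma sq_integrable_sum:
  "(\<And>i. i \<in> I \<Longrightarrow> sq_integrable M (U i)) \<Longrightarrow> sq_integrable M (\<lambda>\<omega>. \<Sum>i\<in>I. U i \<omega>)"
proof (induction I rule: infinite_finite_induct)
  case (insert i I)
  then show ?case by (simp add: sq_integrable_add)
qed (simp_all add: sq_integrable_def)

lemma (in finite_measure) sq_integrable_integrable:
  assumes "sq_integrable M U" shows "integrable M U"
  using sq_integrable_mult[OF assms, of "\<lambda>_. 1"] by (simp add: sq_integrable_def)

lemma msq_nonneg [simp]: "msq M U \<ge> 0"
  by (simp add: msq_def)

lemma msq_eq_integral_mult: "msq M U = (\<integral>\<omega>. U \<omega> * U \<omega> \<partial>M)"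
  by (simp add: msq_def power2_eq_square)

lemma msq_cong_AE:
  assumes "AE \<omega> in M. U \<omega> = V \<omega>" "U \<in> borel_measurable M" "V \<in> borel_measurable M"
  shows "msq M U = msq M V"
  unfolding msq_def using assms by (intro integral_cong_AE) (auto elim: eventually_mono)

lemma msq_diff:
  assumes "sq_integrable M U" "sq_integrable M V"
  shows "msq M (\<lambda>\<omega>. U \<omega> - V \<omega>) = msq M U - 2 * (\<integral>\<omega>. U \<omega> * V \<omega> \<partial>M) + msq M V"
proof -
  have "msq M (\<lambda>\<omega>. U \<omega> - V \<omega>) = (\<integral>\<omega>. ((U \<omega>)\<^sup>2 - 2 * (U \<omega> * V \<omega>)) + (V \<omega>)\<^sup>2 \<partial>M)"
    unfolding msq_def by (intro Bochner_Integration.integral_cong) (auto simp: power2_diff)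
  also have "\<dots> = msq M U - 2 * (\<integral>\<omega>. U \<omega> * V \<omega> \<partial>M) + msq M V"
    using sq_integrable_mult[OF assms] assms by (simp add: sq_integrable_def msq_def)
  finally show ?thesis .
qed

lemma msq_cmult: "msq M (\<lambda>\<omega>. c * U \<omega>) = c\<^sup>2 * msq M U"
  by (simp add: msq_def power_mult_distrib)

text \<open>The Cauchy-Schwarz inequality for finite sums, applied pointwise and then
  integrated.\<close>

lemma msq_sum_le:
  assumes "finite I" "\<And>i. i \<in> I \<Longrightarrow> sq_integrable M (U i)"
  shows "msq M (\<lambda>\<omega>. \<Sum>i\<in>I. U i \<omega>) \<le> real (card I) * (\<Sum>i\<in>I. msq M (U i))"
proof -
  have "msq M (\<lambda>\<omega>. \<Sum>i\<in>I. U i \<omega>) \<le> (\<integral>\<omega>. real (card I) * (\<Sum>i\<in>I. (U i \<omega>)\<^sup>2) \<partial>M)"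
    unfolding msq_def
  proof (rule integral_mono)
    show "integrable M (\<lambda>\<omega>. (\<Sum>i\<in>I. U i \<omega>)\<^sup>2)"
      using sq_integrable_sum[of I M U] assms by (simp add: sq_integrable_def)
    show "integrable M (\<lambda>\<omega>. real (card I) * (\<Sum>i\<in>I. (U i \<omega>)\<^sup>2))"
      using assms by (simp add: sq_integrable_def)
    show "(\<Sum>i\<in>I. U i \<omega>)\<^sup>2 \<le> real (card I) * (\<Sum>i\<in>I. (U i \<omega>)\<^sup>2)" for \<omega>
      using sum_squared_le_sum_of_squares[of "\<lambda>i. U i \<omega>" I] by (simp add: mult.commute)
  qed
  also have "\<dots> = real (card I) * (\<Sum>i\<in>I. msq M (U i))"
    using assms by (simp add: msq_def sq_integrable_def)
  finally show ?thesis .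
qed

lemma msq_sum_orthogonal:
  assumes "finite I" "\<And>i. i \<in> I \<Longrightarrow> sq_integrable M (U i)"
    and "\<And>i j. i \<in> I \<Longrightarrow> j \<in> I \<Longrightarrow> i \<noteq> j \<Longrightarrow> (\<integral>\<omega>. U i \<omega> * U j \<omega> \<partial>M) = 0"
  shows "msq M (\<lambda>\<omega>. \<Sum>i\<in>I. U i \<omega>) = (\<Sum>i\<in>I. msq M (U i))"
proof -
  have "msq M (\<lambda>\<omega>. \<Sum>i\<in>I. U i \<omega>) = (\<Sum>i\<in>I. \<Sum>j\<in>I. \<integral>\<omega>. U i \<omega> * U j \<omega> \<partial>M)"
    unfolding msq_eq_integral_mult sum_product
    using sq_integrable_mult[OF assms(2,2)] by (subst Bochner_Integration.integral_sum; simp)+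
  also have "\<dots> = (\<Sum>i\<in>I. \<Sum>j\<in>I. if i = j then msq M (U i) else 0)"
    using assms(3) by (intro sum.cong refl) (auto simp: msq_eq_integral_mult)
  finally show ?thesis using assms(1) by simp
qed

text \<open>The quadratic polynomial \<open>msq M (U - t V)\<close> in \<open>t\<close> is
  nonnegative; it is evaluated at its minimum \<open>t = c / msq M V\<close>.\<close>

lemma Cauchy_Schwarz_msq:
  assumes U: "sq_integrable M U" and V: "sq_integrable M V"
  shows "(\<integral>\<omega>. U \<omega> * V \<omega> \<partial>M)\<^sup>2 \<le> msq M U * msq M V"
proof -
  define c where "c = (\<integral>\<omega>. U \<omega> * V \<omega> \<partial>M)"
  have le: "2 * t * c \<le> msq M U + t\<^sup>2 * msq M V" for t
    using msq_diff[OF U sq_integrable_cmult[OF V, of t]] msq_nonneg[of M "\<lambda>\<omega>. U \<omega> - t * V \<omega>"]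
    by (simp add: msq_cmult c_def mult.left_commute[of _ t])
  show ?thesis
  proof (cases "msq M V = 0")
    case True
    have "c = 0"
    proof (rule ccontr)
      assume "c \<noteq> 0"
      \<comment> \<open>Without quadratic term the bound reads \<open>2 * t * c <= msq M U\<close>
        for all \<open>t\<close>; this \<open>t\<close> makes the left side
        \<open>msq M U + 1\<close>.\<close>
      with le[of "(msq M U + 1) / (2 * c)"] True show False by simp
    qed
    with True show ?thesis by (simp add: c_def)
  next
    case False
    then have "msq M V > 0" using msq_nonneg[of M V] by linarith
    with le[of "c / msq M V"] show ?thesis
      unfolding c_def[symmetric] by (simp add: field_simps power2_eq_square)
  qed
qed

lemma norm2_sq_eq_msq: "sq_integrable M U \<Longrightarrow> norm2_sq M U = ennreal (msq M U)"
  unfolding norm2_sq_def msq_def by (intro nn_integral_eq_integral) (auto simp: sq_integrable_def)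

text \<open>This turns finiteness of an extended norm, extracted from a limit, into square
  integrability.\<close>

lemma sq_integrable_iff_norm2_sq:
  "sq_integrable M U \<longleftrightarrow> U \<in> borel_measurable M \<and> norm2_sq M U < \<infinity>"
  by (auto simp: sq_integrable_def norm2_sq_def integrable_iff_bounded)

lemma norm2_sq_cong_AE: "AE \<omega> in M. U \<omega> = V \<omega> \<Longrightarrow> norm2_sq M U = norm2_sq M V"
  unfolding norm2_sq_def by (intro nn_integral_cong_AE) auto

lemma AE_sum_cong:
  assumes "finite I" "\<And>i. i \<in> I \<Longrightarrow> AE \<omega> in M. f i \<omega> = g i \<omega>"
  shows "AE \<omega> in M. (\<Sum>i\<in>I. f i \<omega>) = (\<Sum>i\<in>I. (g i \<omega> :: real))"
proof -
  have "AE \<omega> in M. \<forall>i\<in>I. f i \<omega> = g i \<omega>"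
    using assms by (intro AE_finite_allI) auto
  then show ?thesis by eventually_elim (auto intro: sum.cong)
qed

lemma integral_mult_cong_AE:
  fixes U V U' V' :: "'a \<Rightarrow> real"
  assumes "AE \<omega> in M. U \<omega> = U' \<omega>" "AE \<omega> in M. V \<omega> = V' \<omega>"
    "U \<in> borel_measurable M" "U' \<in> borel_measurable M" "V \<in> borel_measurable M" "V' \<in> borel_measurable M"
  shows "(\<integral>\<omega>. U \<omega> * V \<omega> \<partial>M) = (\<integral>\<omega>. U' \<omega> * V' \<omega> \<partial>M)"
  by (intro integral_cong_AE) (use assms in auto)

subsection \<open>Conditional expectations of square integrable functions\<close>

context commuting_field
begin

lemma cond_exp_measurable [measurable]: "cond_exp M a Y \<in> borel_measurable M"
  by (rule borel_measurable_cond_exp2)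

text \<open>Conditional Jensen inequality for the square function.\<close>

lemma sq_integrable_cond_exp:
  assumes "sq_integrable M Y" shows "sq_integrable M (cond_exp M a Y)"
proof -
  have "integrable M (\<lambda>\<omega>. (cond_exp M a Y \<omega>)\<^sup>2)"
    using assms
    by (intro past.integrable_convex_cond_exp[where I=UNIV])
       (auto simp: sq_integrable_def intro: sq_integrable_integrable convex_power_even)
  then show ?thesis by (simp add: sq_integrable_def)
qed

lemma sq_integrable_shift:
  assumes "sq_integrable M Y" shows "sq_integrable M (\<lambda>\<omega>. Y (shift v \<omega>))"
  using assms integrable_shift[of "\<lambda>\<omega>. (Y \<omega>)\<^sup>2"] by (auto simp: sq_integrable_def)

lemma msq_shift: "Y \<in> borel_measurable M \<Longrightarrow> msq M (\<lambda>\<omega>. Y (shift v \<omega>)) = msq M Y"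
  unfolding msq_def by (intro integral_shift) simp

text \<open>Conditional expectation is the orthogonal projection of \<open>L^2\<close>;
  self-adjointness and contractivity below both come from this identity.\<close>

lemma integral_mult_cond_exp:
  assumes "sq_integrable M U" "sq_integrable M V"
  shows "(\<integral>\<omega>. U \<omega> * cond_exp M a V \<omega> \<partial>M) = (\<integral>\<omega>. cond_exp M a U \<omega> * cond_exp M a V \<omega> \<partial>M)"
proof -
  have "(\<integral>\<omega>. cond_exp M a V \<omega> * cond_exp M a U \<omega> \<partial>M) = (\<integral>\<omega>. cond_exp M a V \<omega> * U \<omega> \<partial>M)"
    using assms
    by (intro past.real_cond_exp_intg) (auto intro!: sq_integrable_mult sq_integrable_cond_exp sq_integrable_measurable)
  then show ?thesis by (simp add: mult.commute)
qed

lemma cond_exp_self_adjoint: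
  assumes "sq_integrable M U" "sq_integrable M V"
  shows "(\<integral>\<omega>. cond_exp M a U \<omega> * V \<omega> \<partial>M) = (\<integral>\<omega>. U \<omega> * cond_exp M a V \<omega> \<partial>M)"
  using integral_mult_cond_exp[OF assms, of a] integral_mult_cond_exp[OF assms(2,1), of a]
  by (simp add: mult.commute)

lemma msq_cond_exp_le:
  assumes "sq_integrable M Y" shows "msq M (cond_exp M a Y) \<le> msq M Y"
proof -
  have "0 \<le> msq M (\<lambda>\<omega>. Y \<omega> - cond_exp M a Y \<omega>)" by simp
  also have "\<dots> = msq M Y - msq M (cond_exp M a Y)"
    unfolding msq_diff[OF assms sq_integrable_cond_exp[OF assms]] integral_mult_cond_exp[OF assms assms]
    by (simp add: msq_eq_integral_mult)
  finally show ?thesis by simp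
qed

lemma cond_exp_cong:
  assumes "AE \<omega> in M. U \<omega> = V \<omega>" "U \<in> borel_measurable M" "V \<in> borel_measurable M"
  shows "AE \<omega> in M. cond_exp M a U \<omega> = cond_exp M a V \<omega>"
  using assms by (rule past.real_cond_exp_cong)

lemma cond_exp_lincomb:
  assumes "finite I" "\<And>i. integrable M (f i)"
  shows "AE \<omega> in M. cond_exp M a (\<lambda>\<omega>. \<Sum>i\<in>I. c i * f i \<omega>) \<omega> = (\<Sum>i\<in>I. c i * cond_exp M a (f i) \<omega>)"
proof -
  have "AE \<omega> in M. cond_exp M a (\<lambda>\<omega>. \<Sum>i\<in>I. c i * f i \<omega>) \<omega> = (\<Sum>i\<in>I. cond_exp M a (\<lambda>\<omega>. c i * f i \<omega>) \<omega>)"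
    using assms by (intro past.real_cond_exp_sum) auto
  moreover have "AE \<omega> in M. (\<Sum>i\<in>I. cond_exp M a (\<lambda>\<omega>. c i * f i \<omega>) \<omega>) = (\<Sum>i\<in>I. c i * cond_exp M a (f i) \<omega>)"
    using assms by (intro AE_sum_cong) auto
  ultimately show ?thesis by eventually_elim simp
qed

text \<open>The martingale difference condition at the single site \<open>u\<close>, for square
  integrable functions. Up to null sets these form the range of the projection operator at
  \<open>u\<close>. Conditions are stated almost everywhere, so they survive \<open>L^2\<close>
  limits and changes on null sets.\<close>

definition mdiff :: "int ^ 'd \<Rightarrow> ('d config \<Rightarrow> real) \<Rightarrow> bool" where
  "mdiff u V \<longleftrightarrow> sq_integrable M V \<and> (AE \<omega> in M. cond_exp M u V \<omega> = V \<omega>) \<and>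
     (\<forall>a. \<not> u \<le> a \<longrightarrow> (AE \<omega> in M. cond_exp M a V \<omega> = 0))"

lemma mdiff_sq_integrable: "mdiff u V \<Longrightarrow> sq_integrable M V"
  by (simp add: mdiff_def)

text \<open>Since \<open>V\<close> is fixed by the self-adjoint operator
  \<open>cond_exp M v\<close>, this operator can be moved to \<open>U\<close>, which it
  annihilates.\<close>

lemma mdiff_orthogonal_aux:
  assumes U: "mdiff u U" and V: "mdiff v V" and "\<not> u \<le> v"
  shows "(\<integral>\<omega>. U \<omega> * V \<omega> \<partial>M) = 0"
proof -
  have [measurable]: "U \<in> borel_measurable M" "V \<in> borel_measurable M"
    using U V by (auto simp: mdiff_def sq_integrable_def)
  have "(\<integral>\<omega>. U \<omega> * V \<omega> \<partial>M) = (\<integral>\<omega>. U \<omega> * cond_exp M v V \<omega> \<partial>M)"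
    by (rule integral_mult_cong_AE) (use V in \<open>auto simp: mdiff_def\<close>)
  also have "\<dots> = (\<integral>\<omega>. cond_exp M v U \<omega> * V \<omega> \<partial>M)"
    using U V by (simp add: cond_exp_self_adjoint mdiff_sq_integrable)
  also have "\<dots> = (\<integral>\<omega>. 0 * V \<omega> \<partial>M)"
    by (rule integral_mult_cong_AE) (use U \<open>\<not> u \<le> v\<close> in \<open>auto simp: mdiff_def\<close>)
  finally show ?thesis by simp
qed

lemma mdiff_orthogonal:
  assumes U: "mdiff u U" and V: "mdiff v V" and "u \<noteq> v"
  shows "(\<integral>\<omega>. U \<omega> * V \<omega> \<partial>M) = 0"
proof (cases "u \<le> v")
  case True
  then have "\<not> v \<le> u" using \<open>u \<noteq> v\<close> by simp
  then show ?thesis using mdiff_orthogonal_aux[OF V U] by (simp add: mult.commute)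
qed (use mdiff_orthogonal_aux[OF U V] in simp)

lemma mdiff_lincomb:
  assumes "finite I" "\<And>i. mdiff u (V i)"
  shows "mdiff u (\<lambda>\<omega>. \<Sum>i\<in>I. c i * V i \<omega>)"
proof -
  have sq: "sq_integrable M (V i)" for i
    using assms(2) by (simp add: mdiff_def)
  have E: "AE \<omega> in M. cond_exp M a (\<lambda>\<omega>. \<Sum>i\<in>I. c i * V i \<omega>) \<omega> = (\<Sum>i\<in>I. c i * cond_exp M a (V i) \<omega>)" for a
    using assms(1) sq by (intro cond_exp_lincomb sq_integrable_integrable)
  have "AE \<omega> in M. (\<Sum>i\<in>I. c i * cond_exp M u (V i) \<omega>) = (\<Sum>i\<in>I. c i * V i \<omega>)"
    using assms by (intro AE_sum_cong) (auto simp: mdiff_def elim: eventually_mono)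
  then have "AE \<omega> in M. cond_exp M u (\<lambda>\<omega>. \<Sum>i\<in>I. c i * V i \<omega>) \<omega> = (\<Sum>i\<in>I. c i * V i \<omega>)"
    using E[of u] by eventually_elim simp
  moreover have "AE \<omega> in M. cond_exp M a (\<lambda>\<omega>. \<Sum>i\<in>I. c i * V i \<omega>) \<omega> = 0" if "\<not> u \<le> a" for a
  proof -
    have "AE \<omega> in M. (\<Sum>i\<in>I. c i * cond_exp M a (V i) \<omega>) = (\<Sum>i\<in>I. 0)"
      using assms that by (intro AE_sum_cong) (auto simp: mdiff_def elim: eventually_mono)
    then show ?thesis using E[of a] by eventually_elim simp
  qed
  ultimately show ?thesis
    using sq by (auto simp: mdiff_def intro!: sq_integrable_sum sq_integrable_cmult)
qed

lemma mdiff_diff: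
  assumes "mdiff u U" "mdiff u V"
  shows "mdiff u (\<lambda>\<omega>. U \<omega> - V \<omega>)"
  \<comment> \<open>The difference is the linear combination over the two booleans with coefficients
    1 and -1.\<close>
  using mdiff_lincomb[of "UNIV :: bool set" u "\<lambda>b. if b then U else V" "\<lambda>b. if b then 1 else -1"] assms
  by (simp add: UNIV_bool)

lemma mdiff_shift:
  assumes V: "mdiff u V"
  shows "mdiff (u + v) (\<lambda>\<omega>. V (shift v \<omega>))"
proof -
  have int: "integrable M V" using V by (simp add: mdiff_def sq_integrable_integrable)
  have E: "AE \<omega> in M. cond_exp M a (\<lambda>\<omega>. V (shift v \<omega>)) \<omega> = cond_exp M (a - v) V (shift v \<omega>)" for a
    using cond_exp_shift[OF int, of "a - v" v] by simp
  have "AE \<omega> in M. cond_exp M (u + v) (\<lambda>\<omega>. V (shift v \<omega>)) \<omega> = V (shift v \<omega>)"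
    using E[of "u + v"] AE_shift[of "\<lambda>\<omega>. cond_exp M u V \<omega> = V \<omega>" v] V by (auto simp: mdiff_def)
  moreover have "AE \<omega> in M. cond_exp M a (\<lambda>\<omega>. V (shift v \<omega>)) \<omega> = 0" if "\<not> u + v \<le> a" for a
  proof -
    have "\<not> u \<le> a - v" using that by (auto simp: less_eq_vec_def algebra_simps)
    then show ?thesis
      using E[of a] AE_shift[of "\<lambda>\<omega>. cond_exp M (a - v) V \<omega> = 0" v] V by (auto simp: mdiff_def)
  qed
  ultimately show ?thesis using V by (simp add: mdiff_def sq_integrable_shift)
qed

end

subsection \<open>The projection operators\<close>

text \<open>The product of the commuting operators \<open>E\<^sub>u - E\<^bsub>u - e\<^sub>j\<^esub>\<close>, expanded by inclusion-exclusion.\<close>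

definition altproj :: "('d::finite) config measure \<Rightarrow> int ^ 'd \<Rightarrow> ('d config \<Rightarrow> real) \<Rightarrow> 'd config \<Rightarrow> real" where
  "altproj M u Y \<omega> = (\<Sum>J\<in>UNIV. (-1) ^ card J * cond_exp M (u - indvec J) Y \<omega>)"

lemma le_diff_indvec_iff: "u \<le> u - indvec J \<longleftrightarrow> J = {}"
  by (auto simp: less_eq_vec_def split: if_splits)

context commuting_field
begin

lemma altproj_measurable [measurable]: "altproj M u Y \<in> borel_measurable M"
  unfolding altproj_def[abs_def] by measurable

lemma sq_integrable_altproj: "sq_integrable M Y \<Longrightarrow> sq_integrable M (altproj M u Y)"
  unfolding altproj_def[abs_def] by (intro sq_integrable_sum sq_integrable_cmult sq_integrable_cond_exp)

lemma altproj_cong: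
  assumes "AE \<omega> in M. U \<omega> = V \<omega>" "U \<in> borel_measurable M" "V \<in> borel_measurable M"
  shows "AE \<omega> in M. altproj M u U \<omega> = altproj M u V \<omega>"
  unfolding altproj_def using cond_exp_cong[OF assms]
  by (intro AE_sum_cong) (auto elim: eventually_mono)

lemma altproj_sum:
  assumes "finite I" "\<And>i. integrable M (Y i)"
  shows "AE \<omega> in M. altproj M u (\<lambda>\<omega>. \<Sum>i\<in>I. Y i \<omega>) \<omega> = (\<Sum>i\<in>I. altproj M u (Y i) \<omega>)"
proof -
  have "AE \<omega> in M. altproj M u (\<lambda>\<omega>. \<Sum>i\<in>I. Y i \<omega>) \<omega> =
          (\<Sum>J\<in>UNIV. (-1) ^ card J * (\<Sum>i\<in>I. cond_exp M (u - indvec J) (Y i) \<omega>))"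
    unfolding altproj_def
  proof (intro AE_sum_cong)
    fix J :: "'d set"
    have "AE \<omega> in M. cond_exp M (u - indvec J) (\<lambda>\<omega>. \<Sum>i\<in>I. Y i \<omega>) \<omega> = (\<Sum>i\<in>I. cond_exp M (u - indvec J) (Y i) \<omega>)"
      using assms by (intro past.real_cond_exp_sum)
    then show "AE \<omega> in M. (-1) ^ card J * cond_exp M (u - indvec J) (\<lambda>\<omega>. \<Sum>i\<in>I. Y i \<omega>) \<omega> =
        (-1) ^ card J * (\<Sum>i\<in>I. cond_exp M (u - indvec J) (Y i) \<omega>)"
      by eventually_elim simp
  qed simp
  moreover have "(\<Sum>J\<in>UNIV. (-1) ^ card J * (\<Sum>i\<in>I. cond_exp M (u - indvec J) (Y i) \<omega>))
      = (\<Sum>i\<in>I. altproj M u (Y i) \<omega>)" for \<omega>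
    unfolding altproj_def sum_distrib_left by (rule sum.swap)
  ultimately show ?thesis by simp
qed

lemma altproj_shift:
  assumes "integrable M Y"
  shows "AE \<omega> in M. altproj M (u + v) (\<lambda>\<omega>. Y (shift v \<omega>)) \<omega> = altproj M u Y (shift v \<omega>)"
  unfolding altproj_def
proof (rule AE_sum_cong)
  fix J
  show "AE \<omega> in M. (-1) ^ card J * cond_exp M (u + v - indvec J) (\<lambda>\<omega>. Y (shift v \<omega>)) \<omega> =
      (-1) ^ card J * cond_exp M (u - indvec J) Y (shift v \<omega>)"
    using cond_exp_shift[OF assms, of "u - indvec J" v]
    by (auto simp: algebra_simps elim: eventually_mono)
qed simp

lemma cond_exp_altproj:
  assumes "integrable M Y"
  shows "AE \<omega> in M. cond_exp M a (altproj M u Y) \<omega> = (\<Sum>J\<in>UNIV. (-1) ^ card J * cond_exp M (vmin a (u - indvec J)) Y \<omega>)"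
proof -
  have "AE \<omega> in M. cond_exp M a (altproj M u Y) \<omega> =
          (\<Sum>J\<in>UNIV. (-1) ^ card J * cond_exp M a (cond_exp M (u - indvec J) Y) \<omega>)"
    unfolding altproj_def[abs_def] using assms by (intro cond_exp_lincomb) auto
  moreover have "AE \<omega> in M. (\<Sum>J\<in>UNIV. (-1) ^ card J * cond_exp M a (cond_exp M (u - indvec J) Y) \<omega>) =
      (\<Sum>J\<in>UNIV. (-1) ^ card J * cond_exp M (vmin a (u - indvec J)) Y \<omega>)"
    using cond_exp_cond_exp[OF assms] by (intro AE_sum_cong) (auto elim: eventually_mono)
  ultimately show ?thesis by eventually_elim simp
qed

text \<open>In a coordinate with \<open>a $ i < u $ i\<close>, integrality gives
  \<open>a $ i <= u $ i - 1\<close>. The minimum then does not depend on whether \<open>i\<close>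
  belongs to \<open>J\<close>, and the terms cancel in pairs.\<close>

lemma sum_alternating_vmin_eq_0:
  assumes "\<not> u \<le> a"
  shows "(\<Sum>J\<in>UNIV. (-1) ^ card J * cond_exp M (vmin a (u - indvec J)) Y \<omega>) = 0"
proof -
  obtain i where i: "a $ i < u $ i" using assms by (auto simp: less_eq_vec_def not_le)
  show ?thesis
    by (rule sum_alternating_eq_0[of _ i], rule arg_cong[where f="\<lambda>w. cond_exp M w Y \<omega>"])
       (use i in \<open>auto simp: vec_eq_iff\<close>)
qed

lemma altproj_cond_exp_eq_0:
  assumes "integrable M Y" "\<not> u \<le> a"
  shows "AE \<omega> in M. altproj M u (cond_exp M a Y) \<omega> = 0"
proof -
  have "AE \<omega> in M. cond_exp M (u - indvec J) (cond_exp M a Y) \<omega> = cond_exp M (vmin a (u - indvec J)) Y \<omega>" for J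
    using cond_exp_cond_exp[OF assms(1), of "u - indvec J" a] by (simp add: vmin_commute)
  then have "AE \<omega> in M. altproj M u (cond_exp M a Y) \<omega> = (\<Sum>J\<in>UNIV. (-1) ^ card J * cond_exp M (vmin a (u - indvec J)) Y \<omega>)"
    unfolding altproj_def by (intro AE_sum_cong) (auto elim: eventually_mono)
  then show ?thesis using sum_alternating_vmin_eq_0[OF assms(2)] by simp
qed

text \<open>\<open>cond_exp M u\<close> fixes every term because \<open>u - indvec J <= u\<close>;
  for \<open>a\<close> not above \<open>u\<close> the alternating sum collapses.\<close>

lemma mdiff_altproj:
  assumes "sq_integrable M Y"
  shows "mdiff u (altproj M u Y)"
proof -
  have Y: "integrable M Y" using assms by (rule sq_integrable_integrable)
  have "vmin u (u - indvec J) = u - indvec J" for J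
    by (simp add: vec_eq_iff)
  then have "AE \<omega> in M. cond_exp M u (altproj M u Y) \<omega> = altproj M u Y \<omega>"
    using cond_exp_altproj[OF Y, of u u] by (simp add: altproj_def)
  moreover have "AE \<omega> in M. cond_exp M a (altproj M u Y) \<omega> = 0" if "\<not> u \<le> a" for a
    using cond_exp_altproj[OF Y, of a u] sum_alternating_vmin_eq_0[OF that] by simp
  ultimately show ?thesis using assms by (simp add: mdiff_def sq_integrable_altproj)
qed

text \<open>Each conditional expectation is moved onto \<open>V\<close>. Only \<open>J = {}\<close>
  satisfies \<open>u <= u - indvec J\<close>, so all other terms vanish.\<close>

lemma integral_altproj_mult:
  assumes Y: "sq_integrable M Y" and V: "mdiff u V"
  shows "(\<integral>\<omega>. altproj M u Y \<omega> * V \<omega> \<partial>M) = (\<integral>\<omega>. Y \<omega> * V \<omega> \<partial>M)"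
proof -
  have sV: "sq_integrable M V" using V by (rule mdiff_sq_integrable)
  note [measurable] = sq_integrable_measurable[OF Y] sq_integrable_measurable[OF sV]
  have *: "(\<integral>\<omega>. cond_exp M (u - indvec J) Y \<omega> * V \<omega> \<partial>M) = (if J = {} then \<integral>\<omega>. Y \<omega> * V \<omega> \<partial>M else 0)" for J
  proof -
    have "(\<integral>\<omega>. cond_exp M (u - indvec J) Y \<omega> * V \<omega> \<partial>M) = (\<integral>\<omega>. Y \<omega> * cond_exp M (u - indvec J) V \<omega> \<partial>M)"
      by (rule cond_exp_self_adjoint[OF Y sV])
    also have "\<dots> = (\<integral>\<omega>. Y \<omega> * (if J = {} then V \<omega> else 0) \<partial>M)"
      by (rule integral_mult_cong_AE) (use V le_diff_indvec_iff[of u J] in \<open>auto simp: mdiff_def\<close>)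
    finally show ?thesis by simp
  qed
  have "(\<integral>\<omega>. altproj M u Y \<omega> * V \<omega> \<partial>M) = (\<integral>\<omega>. (\<Sum>J\<in>UNIV. (-1) ^ card J * (cond_exp M (u - indvec J) Y \<omega> * V \<omega>)) \<partial>M)"
    by (simp add: altproj_def sum_distrib_right mult.assoc)
  also have "\<dots> = (\<Sum>J\<in>UNIV. (-1) ^ card J * (\<integral>\<omega>. cond_exp M (u - indvec J) Y \<omega> * V \<omega> \<partial>M))"
    using sq_integrable_mult[OF sq_integrable_cond_exp[OF Y] sV] by simp
  also have "\<dots> = (\<integral>\<omega>. Y \<omega> * V \<omega> \<partial>M)"
    unfolding * by (simp add: if_distrib[of "\<lambda>x. _ * x"] cong: if_cong)
  finally show ?thesis .
qed

text \<open>The expansion is proved after conditioning on an arbitrary \<open>a <= u\<close>,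
  because the next factor conditions the inner result on \<open>u\<close> and on
  \<open>u - axis j 1\<close>. \<open>J\<close> ranges over the coordinates already
  processed.\<close>

lemma cond_exp_foldr_proj_step:
  assumes Y: "integrable M Y" and "distinct js"
  shows "integrable M (foldr (proj_step M u) js Y) \<and>
    (\<forall>a\<le>u. AE \<omega> in M. cond_exp M a (foldr (proj_step M u) js Y) \<omega> =
       (\<Sum>J\<in>Pow (set js). (-1) ^ card J * cond_exp M (vmin a (u - indvec J)) Y \<omega>))"
  using \<open>distinct js\<close>
proof (induction js)
  case Nil
  have "vmin a u = a" if "a \<le> u" for a using that by (rule vmin_eq_left)
  then show ?case using Y by simp
next
  case (Cons j js)
  define Z where "Z = foldr (proj_step M u) js Y"
  have Z: "integrable M Z" and j: "j \<notin> set js"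
    and IH: "\<And>a. a \<le> u \<Longrightarrow> AE \<omega> in M. cond_exp M a Z \<omega> =
      (\<Sum>J\<in>Pow (set js). (-1) ^ card J * cond_exp M (vmin a (u - indvec J)) Y \<omega>)"
    using Cons by (auto simp: Z_def)
  have W: "foldr (proj_step M u) (j # js) Y = (\<lambda>\<omega>. cond_exp M u Z \<omega> - cond_exp M (u - axis j 1) Z \<omega>)"
    by (simp add: Z_def proj_step_def)
  have int: "integrable M (cond_exp M b Z)" for b
    using Z by (rule past.real_cond_exp_int)
  have "AE \<omega> in M. cond_exp M a (\<lambda>\<omega>. cond_exp M u Z \<omega> - cond_exp M (u - axis j 1) Z \<omega>) \<omega> =
       (\<Sum>J\<in>Pow (set (j # js)). (-1) ^ card J * cond_exp M (vmin a (u - indvec J)) Y \<omega>)" if a: "a \<le> u" for a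
  proof -
    \<comment> \<open>By commutation \<open>b\<close> is the index of the second term of the new
      factor after conditioning on \<open>a\<close>; the induction hypothesis is used at
      \<open>a\<close> and at \<open>b\<close>.\<close>
    define b where "b = vmin a (u - axis j 1)"
    have b: "b \<le> u" and au: "vmin a u = a"
      using a by (auto simp: b_def less_eq_vec_def vec_eq_iff min_le_iff_disj)
    have bJ: "vmin b (u - indvec J) = vmin a (u - indvec (insert j J))" if "J \<in> Pow (set js)" for J
      using that j by (auto simp: b_def vec_eq_iff axis_def)
    \<comment> \<open>The subsets are split by membership of \<open>j\<close>. Inserting
      \<open>j\<close> flips the sign and lowers coordinate \<open>j\<close>, which is what passing
      from \<open>a\<close> to \<open>b\<close> does.\<close>
    have "insert j ` Pow (set js) \<inter> Pow (set js) = {}" using j by auto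
    moreover have "inj_on (insert j) (Pow (set js))"
      using j by (intro inj_onI) (metis PowD insert_ident subsetD)
    moreover have "card (insert j J) = Suc (card J)" if "J \<in> Pow (set js)" for J
      using that j by (subst card_insert_disjoint) auto
    ultimately have split: "(\<Sum>J\<in>Pow (set (j # js)). (-1) ^ card J * cond_exp M (vmin a (u - indvec J)) Y \<omega>)
        = (\<Sum>J\<in>Pow (set js). (-1) ^ card J * cond_exp M (vmin a (u - indvec J)) Y \<omega>)
        - (\<Sum>J\<in>Pow (set js). (-1) ^ card J * cond_exp M (vmin b (u - indvec J)) Y \<omega>)" for \<omega>
      by (simp add: Pow_insert sum.union_disjoint Int_commute sum.reindex bJ sum_negf)
    have "AE \<omega> in M. cond_exp M a (\<lambda>\<omega>. cond_exp M u Z \<omega> - cond_exp M (u - axis j 1) Z \<omega>) \<omega> =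
        cond_exp M a (cond_exp M u Z) \<omega> - cond_exp M a (cond_exp M (u - axis j 1) Z) \<omega>"
      using int by (intro past.real_cond_exp_diff)
    then show ?thesis
      using IH[OF a] IH[OF b] cond_exp_cond_exp[OF Z, of a u] cond_exp_cond_exp[OF Z, of a "u - axis j 1"]
      unfolding split au b_def[symmetric] by eventually_elim simp
  qed
  then show ?case unfolding W using int by auto
qed

text \<open>The outermost factor yields a difference of conditional expectations that
  \<open>cond_exp M u\<close> fixes, so the preceding expansion at \<open>a = u\<close> describes
  the composition itself.\<close>

lemma proj_eq_altproj:
  fixes js :: "'d list"
  assumes Y: "integrable M Y" and js: "distinct js" "set js = UNIV"
  shows "AE \<omega> in M. foldr (proj_step M u) js Y \<omega> = altproj M u Y \<omega>"
proof -
  obtain j ks where jk: "js = j # ks" using js(2) by (cases js) auto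
  define Z where "Z = foldr (proj_step M u) ks Y"
  have Z: "integrable M Z"
    using cond_exp_foldr_proj_step[OF Y, of ks] js(1) by (simp add: jk Z_def)
  have W: "foldr (proj_step M u) js Y = (\<lambda>\<omega>. cond_exp M u Z \<omega> - cond_exp M (u - axis j 1) Z \<omega>)"
    by (simp add: Z_def proj_step_def jk)
  have int: "integrable M (cond_exp M b Z)" for b
    using Z by (rule past.real_cond_exp_int)
  have v: "vmin u u = u" "vmin u (u - axis j 1) = u - axis j 1" "\<And>J. vmin u (u - indvec J) = u - indvec J"
    by (auto simp: vec_eq_iff axis_def)
  have 1: "AE \<omega> in M. cond_exp M u (\<lambda>\<omega>. cond_exp M u Z \<omega> - cond_exp M (u - axis j 1) Z \<omega>) \<omega> =
      cond_exp M u (cond_exp M u Z) \<omega> - cond_exp M u (cond_exp M (u - axis j 1) Z) \<omega>"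
    using int by (intro past.real_cond_exp_diff)
  have "AE \<omega> in M. cond_exp M u (\<lambda>\<omega>. cond_exp M u Z \<omega> - cond_exp M (u - axis j 1) Z \<omega>) \<omega> =
      (\<Sum>J\<in>UNIV. (-1) ^ card J * cond_exp M (vmin u (u - indvec J)) Y \<omega>)"
    using cond_exp_foldr_proj_step[OF Y js(1), of u] js(2) by (simp add: W)
  then show ?thesis
    using 1 cond_exp_cond_exp[OF Z, of u u] cond_exp_cond_exp[OF Z, of u "u - axis j 1"]
    unfolding W altproj_def v by eventually_elim simp
qed

end

subsection \<open>Orthogonal decomposition of the partial sums\<close>

locale stationary_field = commuting_field M for M :: "('d::finite) config measure" +
  fixes f :: "'d config \<Rightarrow> real"
  assumes f: "f \<in> past_measurable"
    and sq_integrable_past_field_0: "sq_integrable M (past_field f 0)"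
begin

abbreviation "X \<equiv> past_field f"
abbreviation "S \<equiv> rect_sum X"

lemma X_shift: "X (m + v) = (\<lambda>\<omega>. X m (shift v \<omega>))"
  by (rule ext) (rule past_field_add)

lemma sq_integrable_X: "sq_integrable M (X m)"
  using X_shift[of 0 m] sq_integrable_shift[OF sq_integrable_past_field_0] by simp

lemma integrable_X: "integrable M (X m)"
  by (rule sq_integrable_integrable[OF sq_integrable_X])

lemma cond_exp_X: "AE \<omega> in M. cond_exp M m (X m) \<omega> = X m \<omega>"
  by (rule past.real_cond_exp_F_meas[OF integrable_X past_field_measurable_past[OF f]])

lemma sq_integrable_S: "sq_integrable M (S n)"
  unfolding rect_sum_def[abs_def] by (intro sq_integrable_sum sq_integrable_X)

lemma S_measurable [measurable]: "S n \<in> borel_measurable M"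
  by (rule sq_integrable_measurable[OF sq_integrable_S])

lemma integrable_S: "integrable M (S n)"
  by (rule sq_integrable_integrable[OF sq_integrable_S])

lemma cond_exp_S: "AE \<omega> in M. cond_exp M n (S n) \<omega> = S n \<omega>"
proof -
  have "AE \<omega> in M. cond_exp M n (X m) \<omega> = X m \<omega>" if m: "m \<in> {1..n}" for m
  proof -
    have "AE \<omega> in M. cond_exp M n (cond_exp M m (X m)) \<omega> = cond_exp M n (X m) \<omega>"
      using integrable_X by (intro cond_exp_cong cond_exp_X) auto
    then show ?thesis
      using cond_exp_X[of m] cond_exp_cond_exp[OF integrable_X[of m], of n m] m
      by (auto simp: vmin_eq_right)
  qed
  then have "AE \<omega> in M. (\<Sum>m\<in>{1..n}. cond_exp M n (X m) \<omega>) = S n \<omega>"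
    unfolding rect_sum_def by (intro AE_sum_cong) auto
  moreover have "AE \<omega> in M. cond_exp M n (S n) \<omega> = (\<Sum>m\<in>{1..n}. cond_exp M n (X m) \<omega>)"
    unfolding rect_sum_def[abs_def] by (intro past.real_cond_exp_sum integrable_X)
  ultimately show ?thesis by eventually_elim simp
qed

text \<open>\<open>X m\<close> is its own conditional expectation at \<open>m\<close>, which the
  operator at \<open>u\<close> annihilates unless \<open>u <= m\<close>.\<close>

lemma altproj_X_eq_0:
  assumes "\<not> u \<le> m" shows "AE \<omega> in M. altproj M u (X m) \<omega> = 0"
proof -
  have "AE \<omega> in M. altproj M u (cond_exp M m (X m)) \<omega> = altproj M u (X m) \<omega>"
    using integrable_X by (intro altproj_cong cond_exp_X) auto
  then show ?thesis
    using altproj_cond_exp_eq_0[OF integrable_X[of m] assms] by eventually_elim simp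
qed

text \<open>Only the sites \<open>m >= u\<close> contribute, and the box from \<open>u\<close> to
  \<open>n\<close> is the translate by \<open>u - 1\<close> of the box from 1 to
  \<open>n - u + 1\<close>.\<close>

lemma altproj_S:
  assumes u: "u \<in> {1..n}"
  shows "AE \<omega> in M. altproj M u (S n) \<omega> = altproj M 1 (S (n - u + 1)) (shift (u - 1) \<omega>)"
proof -
  have "AE \<omega> in M. altproj M u (S n) \<omega> = (\<Sum>m\<in>{1..n}. altproj M u (X m) \<omega>)"
    unfolding rect_sum_def[abs_def] by (intro altproj_sum integrable_X) simp
  moreover have "AE \<omega> in M. (\<Sum>m\<in>{1..n}. altproj M u (X m) \<omega>) = (\<Sum>m\<in>{1..n}. if u \<le> m then altproj M u (X m) \<omega> else 0)"
    using altproj_X_eq_0[of u] by (intro AE_sum_cong) auto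
  moreover have "(\<Sum>m\<in>{1..n}. if u \<le> m then altproj M u (X m) \<omega> else 0) = (\<Sum>m\<in>{u..n}. altproj M u (X m) \<omega>)" for \<omega>
    using u by (simp add: sum.If_cases) (intro sum.cong, auto)
  moreover have "AE \<omega> in M. altproj M u (\<lambda>\<omega>. \<Sum>m\<in>{u..n}. X m \<omega>) \<omega> = (\<Sum>m\<in>{u..n}. altproj M u (X m) \<omega>)"
    by (intro altproj_sum integrable_X) simp
  moreover have "(\<lambda>\<omega>. \<Sum>m\<in>{u..n}. X m \<omega>) = (\<lambda>\<omega>. S (n - u + 1) (shift (u - 1) \<omega>))"
    unfolding rect_sum_def past_field_add[symmetric]
    by (intro HOL.ext sum.reindex_bij_witness[of _ "\<lambda>m. m + (u - 1)" "\<lambda>m. m - (u - 1)"])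
       (auto simp: less_eq_vec_def algebra_simps)
  moreover have "AE \<omega> in M. altproj M u (\<lambda>\<omega>. S (n - u + 1) (shift (u - 1) \<omega>)) \<omega> = altproj M 1 (S (n - u + 1)) (shift (u - 1) \<omega>)"
    using altproj_shift[OF integrable_S, of 1 "u - 1"] by simp
  ultimately show ?thesis by auto
qed

definition R :: "int ^ 'd \<Rightarrow> 'd config \<Rightarrow> real" where
  "R n \<omega> = (\<Sum>u\<in>{1..n}. altproj M u (S n) \<omega>)"

definition rest :: "int ^ 'd \<Rightarrow> real" where
  "rest n = msq M (\<lambda>\<omega>. S n \<omega> - R n \<omega>)"

text \<open>\<open>D\<close> is a single function rather than a field, so that the zero function can
  be inserted to describe \<open>msq M (S n)\<close>.\<close>

definition proj_dist :: "('d config \<Rightarrow> real) \<Rightarrow> int ^ 'd \<Rightarrow> real" where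
  "proj_dist D n = (\<Sum>j\<in>{1..n}. msq M (\<lambda>\<omega>. altproj M 1 (S j) \<omega> - D \<omega>))"

lemma rest_nonneg: "rest n \<ge> 0"
  by (simp add: rest_def)

lemma proj_dist_nonneg: "proj_dist D n \<ge> 0"
  by (simp add: proj_dist_def sum_nonneg)

lemma sq_integrable_R: "sq_integrable M (R n)"
  unfolding R_def[abs_def] by (intro sq_integrable_sum sq_integrable_altproj sq_integrable_S)

lemma R_eq:
  assumes "1 \<le> n"
  shows "R n \<omega> = (\<Sum>J\<in>UNIV. (-1) ^ card J * cond_exp M (zero_on J n) (S n) \<omega>)"
  unfolding R_def altproj_def using assms by (rule sum_box_telescope)

text \<open>In the pairing of \<open>R n\<close> with \<open>W\<close>, orthogonality leaves only
  the summand at \<open>u\<close>, which equals the pairing of \<open>S n\<close> with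
  \<open>W\<close>.\<close>

lemma integral_S_minus_R_mult:
  assumes u: "u \<in> {1..n}" and W: "mdiff u W"
  shows "(\<integral>\<omega>. (S n \<omega> - R n \<omega>) * W \<omega> \<partial>M) = 0"
proof -
  have sW: "sq_integrable M W" using W by (rule mdiff_sq_integrable)
  have int: "integrable M (\<lambda>\<omega>. altproj M v (S n) \<omega> * W \<omega>)" for v
    by (intro sq_integrable_mult sq_integrable_altproj sq_integrable_S sW)
  have "(\<integral>\<omega>. R n \<omega> * W \<omega> \<partial>M) = (\<Sum>v\<in>{1..n}. \<integral>\<omega>. altproj M v (S n) \<omega> * W \<omega> \<partial>M)"
    unfolding R_def sum_distrib_right using int by (subst Bochner_Integration.integral_sum) auto
  also have "\<dots> = (\<Sum>v\<in>{1..n}. if v = u then \<integral>\<omega>. S n \<omega> * W \<omega> \<partial>M else 0)"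
    using integral_altproj_mult[OF sq_integrable_S W] mdiff_orthogonal[OF mdiff_altproj[OF sq_integrable_S] W]
    by (intro sum.cong refl) auto
  also have "\<dots> = (\<integral>\<omega>. S n \<omega> * W \<omega> \<partial>M)" using u by simp
  finally show ?thesis
    using sq_integrable_mult[OF sq_integrable_S sW] sq_integrable_mult[OF sq_integrable_R sW]
    by (simp add: left_diff_distrib)
qed

text \<open>Pythagoras for the splitting into \<open>S n - R n\<close> and the differences
  \<open>W u\<close> at the sites of the box, all mutually orthogonal.\<close>

lemma msq_S_minus_mdiff_sum:
  assumes V: "\<And>u. u \<in> {1..n} \<Longrightarrow> mdiff u (V u)"
  shows "msq M (\<lambda>\<omega>. S n \<omega> - (\<Sum>u\<in>{1..n}. V u \<omega>)) =
    rest n + (\<Sum>u\<in>{1..n}. msq M (\<lambda>\<omega>. altproj M u (S n) \<omega> - V u \<omega>))"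
proof -
  define W where "W u \<omega> = V u \<omega> - altproj M u (S n) \<omega>" for u \<omega>
  have W: "mdiff u (W u)" if "u \<in> {1..n}" for u
    unfolding W_def[abs_def] by (intro mdiff_diff V that mdiff_altproj sq_integrable_S)
  have sW: "sq_integrable M (\<lambda>\<omega>. \<Sum>u\<in>{1..n}. W u \<omega>)"
    using W by (intro sq_integrable_sum mdiff_sq_integrable)
  have sSR: "sq_integrable M (\<lambda>\<omega>. S n \<omega> - R n \<omega>)"
    by (intro sq_integrable_diff sq_integrable_S sq_integrable_R)
  have "(\<integral>\<omega>. (S n \<omega> - R n \<omega>) * (\<Sum>u\<in>{1..n}. W u \<omega>) \<partial>M) = (\<Sum>u\<in>{1..n}. \<integral>\<omega>. (S n \<omega> - R n \<omega>) * W u \<omega> \<partial>M)"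
    unfolding sum_distrib_left
    by (rule Bochner_Integration.integral_sum) (intro sq_integrable_mult[OF sSR] mdiff_sq_integrable[OF W])
  then have 0: "(\<integral>\<omega>. (S n \<omega> - R n \<omega>) * (\<Sum>u\<in>{1..n}. W u \<omega>) \<partial>M) = 0"
    using W by (simp add: integral_S_minus_R_mult)
  have "(\<lambda>\<omega>. S n \<omega> - (\<Sum>u\<in>{1..n}. V u \<omega>)) = (\<lambda>\<omega>. (S n \<omega> - R n \<omega>) - (\<Sum>u\<in>{1..n}. W u \<omega>))"
    by (simp add: W_def R_def sum_subtractf)
  then have "msq M (\<lambda>\<omega>. S n \<omega> - (\<Sum>u\<in>{1..n}. V u \<omega>)) = rest n + msq M (\<lambda>\<omega>. \<Sum>u\<in>{1..n}. W u \<omega>)"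
    using msq_diff[OF sSR sW] 0 by (simp add: rest_def)
  also have "msq M (\<lambda>\<omega>. \<Sum>u\<in>{1..n}. W u \<omega>) = (\<Sum>u\<in>{1..n}. msq M (W u))"
    by (rule msq_sum_orthogonal) (simp, rule mdiff_sq_integrable[OF W], assumption, rule mdiff_orthogonal[OF W W])
  also have "\<dots> = (\<Sum>u\<in>{1..n}. msq M (\<lambda>\<omega>. altproj M u (S n) \<omega> - V u \<omega>))"
    unfolding msq_def W_def by (simp add: power2_commute)
  finally show ?thesis .
qed

text \<open>Translating the summand at \<open>u\<close> back to site 1 turns it into the one for
  \<open>j = n - u + 1\<close>, and this substitution reverses the box.\<close>

lemma msq_S_minus_martingale:
  assumes D: "mdiff 1 D"
  shows "msq M (\<lambda>\<omega>. S n \<omega> - (\<Sum>u\<in>{1..n}. D (shift (u - 1) \<omega>))) = rest n + proj_dist D n"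
proof -
  have [measurable]: "D \<in> borel_measurable M"
    using D by (simp add: mdiff_def sq_integrable_def)
  have "mdiff u (\<lambda>\<omega>. D (shift (u - 1) \<omega>))" for u
    using mdiff_shift[OF D, of "u - 1"] by simp
  then have "msq M (\<lambda>\<omega>. S n \<omega> - (\<Sum>u\<in>{1..n}. D (shift (u - 1) \<omega>))) =
      rest n + (\<Sum>u\<in>{1..n}. msq M (\<lambda>\<omega>. altproj M u (S n) \<omega> - D (shift (u - 1) \<omega>)))"
    by (rule msq_S_minus_mdiff_sum)
  also have "(\<Sum>u\<in>{1..n}. msq M (\<lambda>\<omega>. altproj M u (S n) \<omega> - D (shift (u - 1) \<omega>))) =
      (\<Sum>u\<in>{1..n}. msq M (\<lambda>\<omega>. altproj M 1 (S (n - u + 1)) \<omega> - D \<omega>))"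
  proof (intro sum.cong refl)
    fix u assume "u \<in> {1..n}"
    from altproj_S[OF this]
    have "msq M (\<lambda>\<omega>. altproj M u (S n) \<omega> - D (shift (u - 1) \<omega>)) =
        msq M (\<lambda>\<omega>. altproj M 1 (S (n - u + 1)) (shift (u - 1) \<omega>) - D (shift (u - 1) \<omega>))"
      by (intro msq_cong_AE) auto
    also have "\<dots> = msq M (\<lambda>\<omega>. altproj M 1 (S (n - u + 1)) \<omega> - D \<omega>)"
      by (rule msq_shift) simp
    finally show "msq M (\<lambda>\<omega>. altproj M u (S n) \<omega> - D (shift (u - 1) \<omega>)) =
        msq M (\<lambda>\<omega>. altproj M 1 (S (n - u + 1)) \<omega> - D \<omega>)" .
  qed
  also have "\<dots> = proj_dist D n"
    unfolding proj_dist_def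
    by (rule sum.reindex_bij_witness[of _ "\<lambda>j. n - j + 1" "\<lambda>u. n - u + 1"])
       (auto simp: less_eq_vec_def)
  finally show ?thesis .
qed

lemma mdiff_0: "mdiff u (\<lambda>_. 0)"
  \<comment> \<open>The zero function is the empty combination; the constant family of projections
    of \<open>S 0\<close> only serves to meet the premise.\<close>
  using mdiff_lincomb[of "{}" u "\<lambda>_. altproj M u (S 0)"] mdiff_altproj[OF sq_integrable_S] by simp

lemma msq_S: "msq M (S n) = rest n + proj_dist (\<lambda>_. 0) n"
  using msq_S_minus_martingale[OF mdiff_0, of n] by simp

text \<open>Coordinate \<open>j\<close> of \<open>zero_on {j} n\<close> is 0, below that of every
  site in the box, so conditioning annihilates \<open>R n\<close>. What remains is the contraction
  property applied to \<open>S n - R n\<close>.\<close>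

lemma msq_cond_exp_le_rest: "msq M (cond_exp M (zero_on {j} n) (S n)) \<le> rest n"
proof -
  define a where "a = zero_on {j} n"
  have not_le: "\<not> u \<le> a" if "u \<in> {1..n}" for u
    using that by (auto simp: a_def less_eq_vec_def not_le intro!: exI[of _ j])
       (metis less_le_trans zero_less_one)
  have "AE \<omega> in M. cond_exp M a (altproj M u (S n)) \<omega> = 0" if "u \<in> {1..n}" for u
    using mdiff_altproj[OF sq_integrable_S, of u n] not_le[OF that] by (simp add: mdiff_def)
  then have "AE \<omega> in M. (\<Sum>u\<in>{1..n}. cond_exp M a (altproj M u (S n)) \<omega>) = (\<Sum>u\<in>{1..n}. 0)"
    by (intro AE_sum_cong) auto
  moreover have "AE \<omega> in M. cond_exp M a (R n) \<omega> = (\<Sum>u\<in>{1..n}. cond_exp M a (altproj M u (S n)) \<omega>)"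
    unfolding R_def[abs_def]
    by (intro past.real_cond_exp_sum sq_integrable_integrable sq_integrable_altproj sq_integrable_S)
  moreover have "AE \<omega> in M. cond_exp M a (\<lambda>\<omega>. S n \<omega> - R n \<omega>) \<omega> = cond_exp M a (S n) \<omega> - cond_exp M a (R n) \<omega>"
    by (intro past.real_cond_exp_diff integrable_S sq_integrable_integrable sq_integrable_R)
  ultimately have "AE \<omega> in M. cond_exp M a (S n) \<omega> = cond_exp M a (\<lambda>\<omega>. S n \<omega> - R n \<omega>) \<omega>"
    by eventually_elim simp
  then have "msq M (cond_exp M a (S n)) = msq M (cond_exp M a (\<lambda>\<omega>. S n \<omega> - R n \<omega>))"
    by (intro msq_cong_AE) auto
  also have "\<dots> \<le> rest n"
    unfolding rest_def by (intro msq_cond_exp_le sq_integrable_diff sq_integrable_S sq_integrable_R)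
  finally show ?thesis unfolding a_def .
qed

text \<open>In the telescoped form of \<open>R n\<close> the term for \<open>J = {}\<close> is
  \<open>S n\<close> itself, so \<open>S n - R n\<close> is minus the sum over nonempty
  \<open>J\<close>. Each such term is controlled by the one for a singleton \<open>{j}\<close> with
  \<open>j\<close> in \<open>J\<close>.\<close>

lemma rest_le:
  assumes n: "1 \<le> n"
  shows "rest n \<le> 4 ^ CARD('d) * (\<Sum>j\<in>UNIV. msq M (cond_exp M (zero_on {j} n) (S n)))"
proof -
  define U where "U J \<omega> = (-1) ^ card J * cond_exp M (zero_on J n) (S n) \<omega>" for J \<omega>
  define T where "T = (\<Sum>j\<in>UNIV. msq M (cond_exp M (zero_on {j} n) (S n)))"
  have n0: "0 \<le> n $ i" for i
    using n by (auto simp: less_eq_vec_def intro: order_trans[OF zero_le_one])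
  have sU: "sq_integrable M (U J)" for J
    unfolding U_def[abs_def] by (intro sq_integrable_cmult sq_integrable_cond_exp sq_integrable_S)
  have T: "msq M (U J) \<le> T" if "J \<noteq> {}" for J
  proof -
    obtain j where j: "j \<in> J" using \<open>J \<noteq> {}\<close> by auto
    \<comment> \<open>Nonnegativity of \<open>n\<close> enters here: replacing further coordinates
      by 0 can only lower the index, so conditioning factors through
      \<open>zero_on {j} n\<close>.\<close>
    have "vmin (zero_on J n) (zero_on {j} n) = zero_on J n"
      using j n0 by (auto simp: vec_eq_iff)
    then have "AE \<omega> in M. cond_exp M (zero_on J n) (S n) \<omega> = cond_exp M (zero_on J n) (cond_exp M (zero_on {j} n) (S n)) \<omega>"
      using cond_exp_cond_exp[OF integrable_S, of "zero_on J n" "zero_on {j} n" n] by auto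
    then have "msq M (cond_exp M (zero_on J n) (S n)) = msq M (cond_exp M (zero_on J n) (cond_exp M (zero_on {j} n) (S n)))"
      by (intro msq_cong_AE) auto
    also have "\<dots> \<le> msq M (cond_exp M (zero_on {j} n) (S n))"
      by (intro msq_cond_exp_le sq_integrable_cond_exp sq_integrable_S)
    also have "\<dots> \<le> T"
      unfolding T_def by (rule member_le_sum) auto
    also have "msq M (cond_exp M (zero_on J n) (S n)) = msq M (U J)"
      unfolding U_def msq_cmult by (simp flip: power_mult)
    finally show ?thesis .
  qed
  have "zero_on {} n = n" by (simp add: vec_eq_iff)
  moreover have "(\<Sum>J\<in>UNIV. U J \<omega>) = U {} \<omega> + (\<Sum>J\<in>UNIV - {{}}. U J \<omega>)" for \<omega>
    by (rule sum.remove) auto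
  ultimately have "R n \<omega> = cond_exp M n (S n) \<omega> + (\<Sum>J\<in>UNIV - {{}}. U J \<omega>)" for \<omega>
    by (simp add: R_eq[OF n] U_def)
  then have "AE \<omega> in M. S n \<omega> - R n \<omega> = (-1) * (\<Sum>J\<in>UNIV - {{}}. U J \<omega>)"
    using cond_exp_S[of n] by (auto elim: eventually_mono)
  then have "rest n = msq M (\<lambda>\<omega>. (-1) * (\<Sum>J\<in>UNIV - {{}}. U J \<omega>))"
    unfolding rest_def using sU
    by (intro msq_cong_AE)
       (auto intro!: sq_integrable_measurable sq_integrable_diff sq_integrable_S sq_integrable_R sq_integrable_sum sq_integrable_cmult)
  also have "\<dots> = msq M (\<lambda>\<omega>. \<Sum>J\<in>UNIV - {{}}. U J \<omega>)"
    by (subst msq_cmult) simp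
  also have "\<dots> \<le> real (card (UNIV - {{} :: 'd set})) * (\<Sum>J\<in>UNIV - {{}}. msq M (U J))"
    by (intro msq_sum_le sU) simp
  \<comment> \<open>One factor comes from Cauchy-Schwarz over at most \<open>2 ^ CARD('d)\<close>
    terms, the other from bounding each of these terms by \<open>T\<close>.\<close>
  also have "\<dots> \<le> 2 ^ CARD('d) * (2 ^ CARD('d) * T)"
  proof (rule mult_mono)
    have c: "real (card (UNIV - {{} :: 'd set})) \<le> 2 ^ CARD('d)"
    proof -
      have "card (UNIV - {{} :: 'd set}) \<le> card (UNIV :: 'd set set)" by (rule card_mono) auto
      also have "\<dots> = 2 ^ CARD('d)" by (metis Pow_UNIV card_Pow finite)
      finally show ?thesis by (metis of_nat_le_iff of_nat_numeral of_nat_power)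
    qed
    then show "real (card (UNIV - {{} :: 'd set})) \<le> 2 ^ CARD('d)" .
    have "(\<Sum>J\<in>UNIV - {{} :: 'd set}. msq M (U J)) \<le> real (card (UNIV - {{} :: 'd set})) * T"
      by (rule sum_bounded_above) (use T in auto)
    also have "\<dots> \<le> 2 ^ CARD('d) * T"
      using c by (intro mult_right_mono) (auto simp: T_def sum_nonneg)
    finally show "(\<Sum>J\<in>UNIV - {{} :: 'd set}. msq M (U J)) \<le> 2 ^ CARD('d) * T" .
  qed (auto simp: sum_nonneg)
  also have "\<dots> = 4 ^ CARD('d) * T"
    by (simp flip: power_mult_distrib mult.assoc)
  finally show ?thesis unfolding T_def .
qed

section \<open>Averages of the projections at site 1\<close>

definition proj_mean :: "int ^ 'd \<Rightarrow> 'd config \<Rightarrow> real" where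
  "proj_mean n \<omega> = (\<Sum>j\<in>{1..n}. altproj M 1 (S j) \<omega>) / vol n"

lemma mdiff_proj_mean: "mdiff 1 (proj_mean n)"
  using mdiff_lincomb[of "{1..n}" 1 "\<lambda>j. altproj M 1 (S j)" "\<lambda>_. 1 / vol n"] mdiff_altproj[OF sq_integrable_S]
  by (simp add: proj_mean_def[abs_def] sum_divide_distrib)

lemma sq_integrable_proj_mean: "sq_integrable M (proj_mean n)"
  by (rule mdiff_sq_integrable[OF mdiff_proj_mean])

text \<open>Expand each square: the cross terms add up to the pairing with the average, and
  \<open>msq M D\<close> is counted once per point of the box.\<close>

lemma proj_dist_eq:
  assumes n: "1 \<le> n" and D: "sq_integrable M D"
  shows "proj_dist D n / vol n = proj_dist (\<lambda>_. 0) n / vol n - 2 * (\<integral>\<omega>. proj_mean n \<omega> * D \<omega> \<partial>M) + msq M D"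
proof -
  have int: "integrable M (\<lambda>\<omega>. altproj M 1 (S j) \<omega> * D \<omega>)" for j
    by (intro sq_integrable_mult sq_integrable_altproj sq_integrable_S D)
  have "(\<integral>\<omega>. proj_mean n \<omega> * D \<omega> \<partial>M) = (\<Sum>j\<in>{1..n}. \<integral>\<omega>. altproj M 1 (S j) \<omega> * D \<omega> \<partial>M) / vol n"
    using int by (simp add: proj_mean_def sum_distrib_right)
  moreover have "proj_dist D n = (\<Sum>j\<in>{1..n}. msq M (altproj M 1 (S j)) - 2 * (\<integral>\<omega>. altproj M 1 (S j) \<omega> * D \<omega> \<partial>M) + msq M D)"
    unfolding proj_dist_def using msq_diff[OF sq_integrable_altproj[OF sq_integrable_S] D] by simp
  ultimately show ?thesis
    using card_box[OF n] vol_pos[OF n]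
    by (simp add: proj_dist_def sum.distrib sum_subtractf sum_distrib_left[symmetric] field_simps)
qed

text \<open>The squared distance of an average is at most the average of the squared
  distances.\<close>

lemma msq_proj_mean_le:
  assumes n: "1 \<le> n" and D: "sq_integrable M D"
  shows "msq M (\<lambda>\<omega>. proj_mean n \<omega> - D \<omega>) \<le> proj_dist D n / vol n"
proof -
  have "(\<lambda>\<omega>. proj_mean n \<omega> - D \<omega>) = (\<lambda>\<omega>. 1 / vol n * (\<Sum>j\<in>{1..n}. altproj M 1 (S j) \<omega> - D \<omega>))"
    using card_box[OF n] vol_pos[OF n] by (simp add: proj_mean_def sum_subtractf diff_divide_distrib)
  then have "msq M (\<lambda>\<omega>. proj_mean n \<omega> - D \<omega>) = (1 / vol n)\<^sup>2 * msq M (\<lambda>\<omega>. \<Sum>j\<in>{1..n}. altproj M 1 (S j) \<omega> - D \<omega>)"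
    by (simp only: msq_cmult)
  also have "\<dots> \<le> (1 / vol n)\<^sup>2 * (real (card {1..n}) * proj_dist D n)"
    unfolding proj_dist_def
    by (intro mult_left_mono msq_sum_le sq_integrable_diff sq_integrable_altproj sq_integrable_S D) auto
  also have "\<dots> = proj_dist D n / vol n"
    using card_box[OF n] vol_pos[OF n] by (simp add: power2_eq_square)
  finally show ?thesis .
qed

end

subsection \<open>Limits over large boxes\<close>

lemma eventually_min_at_top_ge_1: "\<forall>\<^sub>F n in min_at_top. 1 \<le> (n :: int ^ ('d::finite))"
proof -
  have "1 \<le> n" if "Min (range (\<lambda>i. n $ i)) \<ge> 1" for n :: "int ^ 'd"
    using that by (auto simp: less_eq_vec_def)
  then show ?thesis
    unfolding min_at_top_def eventually_filtercomap
    by (intro exI[of _ "\<lambda>k. k \<ge> 1"]) (auto intro: eventually_ge_at_top)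
qed

lemma min_at_top_neq_bot [simp]: "min_at_top \<noteq> (bot :: (int ^ ('d::finite)) filter)"
  unfolding min_at_top_def
proof (rule filtercomap_neq_bot)
  fix P :: "int \<Rightarrow> bool" assume "eventually P at_top"
  then obtain k where "P k" by (auto simp: eventually_at_top_linorder)
  then have "P (Min (range (\<lambda>i. (\<chi> i. (k :: int)) $ (i :: 'd))))" by simp
  then show "\<exists>n::int ^ 'd. P (Min (range (\<lambda>i. n $ i)))" by blast
qed

text \<open>Passing between extended and real quotients is legitimate eventually, namely once
  \<open>1 <= n\<close> makes \<open>vol n\<close> positive.\<close>

lemma tendsto_ennreal_divide_vol_iff:
  assumes "\<And>n. Q n \<ge> 0" "l \<ge> 0"
  shows "((\<lambda>n. ennreal (Q n) / ennreal (vol n)) \<longlongrightarrow> ennreal l) min_at_top \<longleftrightarrow>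
    ((\<lambda>n. Q n / vol n) \<longlongrightarrow> l) min_at_top"
proof -
  have "((\<lambda>n. ennreal (Q n) / ennreal (vol n)) \<longlongrightarrow> ennreal l) min_at_top \<longleftrightarrow>
      ((\<lambda>n. ennreal (Q n / vol n)) \<longlongrightarrow> ennreal l) min_at_top"
    by (rule tendsto_cong, rule eventually_mono[OF eventually_min_at_top_ge_1])
       (simp add: divide_ennreal assms vol_pos)
  also have "\<dots> \<longleftrightarrow> ((\<lambda>n. Q n / vol n) \<longlongrightarrow> l) min_at_top"
    by (rule tendsto_ennreal_iff, rule eventually_mono[OF eventually_min_at_top_ge_1])
       (auto intro: divide_nonneg_pos[OF assms(1) vol_pos] assms(2))
  finally show ?thesis .
qed

text \<open>An infinite value divided by the finite \<open>vol n\<close> stays infinite, whereas the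
  quotients are eventually below 1. This recovers square integrability for differences assumed only
  integrable.\<close>

lemma finite_norm2_sq_witness:
  assumes "((\<lambda>n. Q n / ennreal (vol n)) \<longlongrightarrow> 0) (min_at_top :: (int ^ ('d::finite)) filter)"
  obtains n :: "int ^ 'd" where "1 \<le> n" "Q n < \<infinity>"
proof -
  have "\<forall>\<^sub>F n in (min_at_top :: (int ^ 'd) filter). Q n / ennreal (vol n) < 1"
    by (rule order_tendstoD(2)[OF assms]) simp
  then have "\<forall>\<^sub>F n in (min_at_top :: (int ^ 'd) filter). 1 \<le> n \<and> Q n < \<infinity>"
    using eventually_min_at_top_ge_1
    by eventually_elim (auto simp: less_top[symmetric] ennreal_top_divide)
  then show ?thesis
    using that eventually_happens'[OF min_at_top_neq_bot] by blast
qed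

lemma tendsto_add_nonneg_0_iff:
  fixes g h :: "'a \<Rightarrow> real"
  assumes "\<forall>\<^sub>F x in F. g x \<ge> 0" "\<forall>\<^sub>F x in F. h x \<ge> 0"
  shows "((\<lambda>x. g x + h x) \<longlongrightarrow> 0) F \<longleftrightarrow> (g \<longlongrightarrow> 0) F \<and> (h \<longlongrightarrow> 0) F"
proof (intro iffI conjI)
  assume *: "((\<lambda>x. g x + h x) \<longlongrightarrow> 0) F"
  show "(g \<longlongrightarrow> 0) F"
    by (rule tendsto_sandwich[OF assms(1) _ tendsto_const *], rule eventually_mono[OF assms(2)]) simp
  show "(h \<longlongrightarrow> 0) F"
    by (rule tendsto_sandwich[OF assms(2) _ tendsto_const *], rule eventually_mono[OF assms(1)]) simp
qed (use tendsto_add[of g 0 F h 0] in simp)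

lemma sq_integrable_cong_AE:
  assumes "AE \<omega> in M. U \<omega> = V \<omega>" "U \<in> borel_measurable M" "sq_integrable M V"
  shows "sq_integrable M U"
  using assms norm2_sq_cong_AE[OF assms(1)] by (simp add: sq_integrable_iff_norm2_sq)

text \<open>The parallelogram identity with the square of the sum discarded; the sum is written as a
  difference from \<open>(-1) * V\<close>.\<close>

lemma msq_diff_le:
  assumes U: "sq_integrable M U" and V: "sq_integrable M V"
  shows "msq M (\<lambda>\<omega>. U \<omega> - V \<omega>) \<le> 2 * (msq M U + msq M V)"
  using msq_diff[OF U V] msq_diff[OF U sq_integrable_cmult[OF V, of "-1"]]
    msq_nonneg[of M "\<lambda>\<omega>. U \<omega> - (-1) * V \<omega>"] msq_cmult[of M "-1" V]
  by simp

text \<open>Norm convergence implies convergence of the pairings with \<open>D\<close>, by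
  Cauchy-Schwarz.\<close>

lemma integral_mult_tendsto:
  assumes A: "\<And>n. sq_integrable M (A n)" and D: "sq_integrable M D"
    and lim: "((\<lambda>n. msq M (\<lambda>\<omega>. A n \<omega> - D \<omega>)) \<longlongrightarrow> 0) F"
  shows "((\<lambda>n. \<integral>\<omega>. A n \<omega> * D \<omega> \<partial>M) \<longlongrightarrow> msq M D) F"
proof -
  have "((\<lambda>n. (\<integral>\<omega>. (A n \<omega> - D \<omega>) * D \<omega> \<partial>M)\<^sup>2) \<longlongrightarrow> 0) F"
  proof (rule tendsto_sandwich[of "\<lambda>_. 0" _ F "\<lambda>n. msq M (\<lambda>\<omega>. A n \<omega> - D \<omega>) * msq M D"])
    show "\<forall>\<^sub>F n in F. (\<integral>\<omega>. (A n \<omega> - D \<omega>) * D \<omega> \<partial>M)\<^sup>2 \<le> msq M (\<lambda>\<omega>. A n \<omega> - D \<omega>) * msq M D"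
      using Cauchy_Schwarz_msq[OF sq_integrable_diff[OF A D] D] by simp
    show "((\<lambda>n. msq M (\<lambda>\<omega>. A n \<omega> - D \<omega>) * msq M D) \<longlongrightarrow> 0) F"
      using tendsto_mult_right[OF lim, of "msq M D"] by simp
  qed auto
  then have "((\<lambda>n. \<integral>\<omega>. (A n \<omega> - D \<omega>) * D \<omega> \<partial>M) \<longlongrightarrow> 0) F"
    using tendsto_real_sqrt[of "\<lambda>n. (\<integral>\<omega>. (A n \<omega> - D \<omega>) * D \<omega> \<partial>M)\<^sup>2" 0 F] by (simp add: tendsto_rabs_zero_iff)
  moreover have "(\<integral>\<omega>. (A n \<omega> - D \<omega>) * D \<omega> \<partial>M) = (\<integral>\<omega>. A n \<omega> * D \<omega> \<partial>M) - msq M D" for n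
    using sq_integrable_mult[OF A D] sq_integrable_mult[OF D D]
    by (simp add: left_diff_distrib msq_eq_integral_mult)
  ultimately show ?thesis by (simp add: LIM_zero_iff)
qed

subsection \<open>Martingale differences fields\<close>

context commuting_field
begin

lemma past_field_measurable_M: "g \<in> past_measurable \<Longrightarrow> past_field g m \<in> borel_measurable M"
  by (rule past_measurable_M[OF past_field_measurable_past])

lemma mdiff_cong_AE:
  assumes "AE \<omega> in M. U \<omega> = V \<omega>" "U \<in> borel_measurable M" "mdiff u V"
  shows "mdiff u U"
proof -
  have *: "AE \<omega> in M. cond_exp M a U \<omega> = cond_exp M a V \<omega>" for a
    using assms by (intro cond_exp_cong) (auto simp: mdiff_def sq_integrable_def)
  have "AE \<omega> in M. cond_exp M u U \<omega> = U \<omega>"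
    using *[of u] assms(1,3) by (auto simp: mdiff_def)
  moreover have "AE \<omega> in M. cond_exp M a U \<omega> = 0" if "\<not> u \<le> a" for a
    using *[of a] that assms(3) by (auto simp: mdiff_def)
  moreover have "sq_integrable M U"
    using assms by (auto simp: mdiff_def intro: sq_integrable_cong_AE)
  ultimately show ?thesis by (simp add: mdiff_def)
qed

text \<open>The defining equations say that bounded operators on \<open>L^2\<close> vanish at the
  function, so they pass to limits in norm. This gives the martingale property of a \<open>D\<close>
  known only as a limit of averages.\<close>

lemma mdiff_limit:
  assumes A: "\<And>n. mdiff u (A n)" and D: "sq_integrable M D" and F: "F \<noteq> bot"
    and lim: "((\<lambda>n. msq M (\<lambda>\<omega>. A n \<omega> - D \<omega>)) \<longlongrightarrow> 0) F"
  shows "mdiff u D"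
proof -
  have sA: "sq_integrable M (A n)" for n using A by (rule mdiff_sq_integrable)
  note sq = sq_integrable_integrable[OF sA] sq_integrable_integrable[OF D] sq_integrable_measurable[OF D] sq_integrable_measurable[OF sA]
  \<comment> \<open>A fixed function whose norm is dominated by a quantity tending to 0 is null;
    both defining equations are reduced to this.\<close>
  have AE_0: "AE \<omega> in M. Z \<omega> = 0" if Z: "sq_integrable M Z" "\<And>n. msq M Z \<le> c * msq M (\<lambda>\<omega>. A n \<omega> - D \<omega>)" for Z c
  proof -
    have "msq M Z \<le> 0"
      by (rule tendsto_lowerbound[OF _ _ F, of "\<lambda>n. c * msq M (\<lambda>\<omega>. A n \<omega> - D \<omega>)"])
         (use tendsto_mult_left[OF lim, of c] Z(2) in auto)
    then have "(\<integral>\<omega>. (Z \<omega>)\<^sup>2 \<partial>M) = 0" using msq_nonneg[of M Z] unfolding msq_def by linarith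
    then show ?thesis
      using Z(1) by (subst (asm) integral_nonneg_eq_0_iff_AE) (auto simp: sq_integrable_def)
  qed
  have diff: "AE \<omega> in M. cond_exp M a (\<lambda>\<omega>. A n \<omega> - D \<omega>) \<omega> = cond_exp M a (A n) \<omega> - cond_exp M a D \<omega>" for a n
    by (intro past.real_cond_exp_diff sq)
  have "AE \<omega> in M. cond_exp M a D \<omega> = 0" if "\<not> u \<le> a" for a
  proof (rule AE_0[of _ 1])
    show "sq_integrable M (cond_exp M a D)" using D by (rule sq_integrable_cond_exp)
    fix n
    have "AE \<omega> in M. cond_exp M a (A n) \<omega> = 0" using A that by (simp add: mdiff_def)
    with diff[of a n]
    have "AE \<omega> in M. cond_exp M a D \<omega> = (-1) * cond_exp M a (\<lambda>\<omega>. A n \<omega> - D \<omega>) \<omega>"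
      by eventually_elim simp
    then have "msq M (cond_exp M a D) = msq M (\<lambda>\<omega>. (-1) * cond_exp M a (\<lambda>\<omega>. A n \<omega> - D \<omega>) \<omega>)"
      by (intro msq_cong_AE) auto
    also have "\<dots> = msq M (cond_exp M a (\<lambda>\<omega>. A n \<omega> - D \<omega>))"
      by (subst msq_cmult) simp
    also have "\<dots> \<le> 1 * msq M (\<lambda>\<omega>. A n \<omega> - D \<omega>)"
      using msq_cond_exp_le[OF sq_integrable_diff[OF sA D]] by simp
    finally show "msq M (cond_exp M a D) \<le> 1 * msq M (\<lambda>\<omega>. A n \<omega> - D \<omega>)" .
  qed
  moreover have "AE \<omega> in M. cond_exp M u D \<omega> - D \<omega> = 0"
  \<comment> \<open>The 4 is the 2 of \<open>msq_diff_le\<close> times the two terms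
    \<open>msq M Z\<close> and \<open>msq M (cond_exp M u Z)\<close>, the second being at most the
    first.\<close>
  proof (rule AE_0[of _ 4])
    show "sq_integrable M (\<lambda>\<omega>. cond_exp M u D \<omega> - D \<omega>)" using D by (intro sq_integrable_diff sq_integrable_cond_exp)
    fix n
    define Z where "Z = (\<lambda>\<omega>. A n \<omega> - D \<omega>)"
    have Z: "sq_integrable M Z" unfolding Z_def by (rule sq_integrable_diff[OF sA D])
    have "AE \<omega> in M. cond_exp M u (A n) \<omega> = A n \<omega>" using A by (simp add: mdiff_def)
    with diff[of u n]
    have "AE \<omega> in M. cond_exp M u D \<omega> - D \<omega> = Z \<omega> - cond_exp M u Z \<omega>"
      unfolding Z_def by eventually_elim simp
    then have "msq M (\<lambda>\<omega>. cond_exp M u D \<omega> - D \<omega>) = msq M (\<lambda>\<omega>. Z \<omega> - cond_exp M u Z \<omega>)"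
      using sq sq_integrable_measurable[OF Z] by (intro msq_cong_AE) auto
    also have "\<dots> \<le> 2 * (msq M Z + msq M (cond_exp M u Z))"
      by (rule msq_diff_le[OF Z sq_integrable_cond_exp[OF Z]])
    also have "\<dots> \<le> 4 * msq M Z"
      using msq_cond_exp_le[OF Z, of u] by simp
    finally show "msq M (\<lambda>\<omega>. cond_exp M u D \<omega> - D \<omega>) \<le> 4 * msq M (\<lambda>\<omega>. A n \<omega> - D \<omega>)"
      unfolding Z_def .
  qed
  ultimately show ?thesis using D by (auto simp: mdiff_def)
qed

lemma martingale_differences_measurable:
  "martingale_differences M D \<Longrightarrow> D m \<in> borel_measurable M"
  by (auto simp: martingale_differences_def intro: past_field_measurable_M)

lemma martingale_differences_shift:
  "martingale_differences M D \<Longrightarrow> D u \<omega> = D 1 (shift (u - 1) \<omega>)"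
  using past_field_add[of _ 1 "u - 1" \<omega>] by (auto simp: martingale_differences_def)

lemma martingale_differences_cond_exp_0:
  assumes "martingale_differences M D" "\<not> m \<le> a"
  shows "AE \<omega> in M. cond_exp M a (D m) \<omega> = 0"
  using assms by (auto simp: martingale_differences_def less_eq_vec_def not_le)

lemma martingale_differences_cond_exp_same:
  assumes "martingale_differences M D"
  shows "AE \<omega> in M. cond_exp M m (D m) \<omega> = D m \<omega>"
proof -
  obtain g where g: "g \<in> past_measurable" "D = past_field g"
    using assms by (auto simp: martingale_differences_def)
  show ?thesis
    by (rule past.real_cond_exp_F_meas)
       (use assms past_field_measurable_past[OF g(1)] g(2) in \<open>auto simp: martingale_differences_def\<close>)
qed

lemma mdiff_martingale_differences:
  assumes "martingale_differences M D" "sq_integrable M (D m)"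
  shows "mdiff m (D m)"
  using assms martingale_differences_cond_exp_0 martingale_differences_cond_exp_same
  by (auto simp: mdiff_def)

text \<open>\<open>V\<close> is measurable for the past of 1 only up to a null set, so it is first
  replaced by the version \<open>cond_exp M 1 V\<close>, which factors through the past. The
  resulting field consists of translates of its value at 1.\<close>

lemma mdiff_extends_to_field:
  assumes V: "mdiff 1 V"
  obtains D where "martingale_differences M D" "AE \<omega> in M. D 1 \<omega> = V \<omega>" "mdiff 1 (D 1)"
proof -
  obtain g where g: "g \<in> past_measurable" "past_field g 1 = cond_exp M 1 V"
    using past_measurable_factor[OF borel_measurable_cond_exp] by blast
  define D where "D = past_field g"
  have 1: "AE \<omega> in M. D 1 \<omega> = V \<omega>"
    using V by (simp add: D_def g(2) mdiff_def)
  have m1: "mdiff 1 (D 1)"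
    by (rule mdiff_cong_AE[OF 1 _ V]) (simp add: D_def g(2))
  have D: "mdiff m (D m)" for m
    using mdiff_shift[OF m1, of "m - 1"] past_field_add[of g 1 "m - 1", abs_def]
    by (simp add: D_def)
  have "\<not> m \<le> a" if "a $ i < m $ i" for a m :: "int ^ 'd" and i
    using that by (auto simp: less_eq_vec_def not_le)
  then have "martingale_differences M D"
    unfolding martingale_differences_def
    using g(1) D sq_integrable_integrable[OF mdiff_sq_integrable[OF D]] by (auto simp: D_def mdiff_def)
  with 1 m1 show ?thesis using that by blast
qed

end

section \<open>Reduction of the four statements to limits of \<open>rest\<close> and
  \<open>proj_dist\<close>\<close>

context stationary_field
begin

lemma norm2_sq_S_minus_rect_sum:
  assumes D: "martingale_differences M D" and sq: "sq_integrable M (D 1)"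
  shows "norm2_sq M (\<lambda>\<omega>. S n \<omega> - rect_sum D n \<omega>) = ennreal (rest n + proj_dist (D 1) n)"
proof -
  have m: "mdiff 1 (D 1)" using mdiff_martingale_differences[OF D sq] .
  have eq: "(\<lambda>\<omega>. S n \<omega> - rect_sum D n \<omega>) = (\<lambda>\<omega>. S n \<omega> - (\<Sum>u\<in>{1..n}. D 1 (shift (u - 1) \<omega>)))"
    unfolding rect_sum_def[of D] martingale_differences_shift[OF D, symmetric] ..
  have "sq_integrable M (\<lambda>\<omega>. S n \<omega> - (\<Sum>u\<in>{1..n}. D 1 (shift (u - 1) \<omega>)))"
    by (intro sq_integrable_diff sq_integrable_S sq_integrable_sum sq_integrable_shift sq)
  then show ?thesis
    unfolding eq by (simp add: norm2_sq_eq_msq msq_S_minus_martingale[OF m])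
qed

text \<open>The partial sum of \<open>D\<close> is square integrable as a difference of two such
  functions. Conditioning it on site 1 annihilates every other site of the box, leaving
  \<open>D 1\<close>.\<close>

lemma sq_integrable_of_rect_sum:
  assumes D: "martingale_differences M D" and n: "1 \<le> n"
    and "norm2_sq M (\<lambda>\<omega>. S n \<omega> - rect_sum D n \<omega>) < \<infinity>"
  shows "sq_integrable M (D 1)"
proof -
  have [measurable]: "D m \<in> borel_measurable M" for m
    by (rule martingale_differences_measurable[OF D])
  have "(\<lambda>\<omega>. S n \<omega> - rect_sum D n \<omega>) \<in> borel_measurable M"
    unfolding rect_sum_def[of D, abs_def] by measurable
  then have "sq_integrable M (\<lambda>\<omega>. S n \<omega> - rect_sum D n \<omega>)"
    using assms(3) by (simp add: sq_integrable_iff_norm2_sq)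
  from sq_integrable_diff[OF sq_integrable_S[of n] this] have sq: "sq_integrable M (rect_sum D n)"
    by simp
  have "AE \<omega> in M. cond_exp M 1 (rect_sum D n) \<omega> = (\<Sum>u\<in>{1..n}. cond_exp M 1 (D u) \<omega>)"
    unfolding rect_sum_def[of D, abs_def] using D
    by (intro past.real_cond_exp_sum) (simp add: martingale_differences_def)
  moreover have "AE \<omega> in M. (\<Sum>u\<in>{1..n}. cond_exp M 1 (D u) \<omega>) = (\<Sum>u\<in>{1..n}. if u = 1 then D 1 \<omega> else 0)"
  proof (rule AE_sum_cong)
    fix u assume "u \<in> {1..n}"
    then have "\<not> u \<le> 1" if "u \<noteq> 1" using that by (metis atLeastAtMost_iff order_antisym)
    then show "AE \<omega> in M. cond_exp M 1 (D u) \<omega> = (if u = 1 then D 1 \<omega> else 0)"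
      using martingale_differences_cond_exp_0[OF D, of u 1] martingale_differences_cond_exp_same[OF D, of 1]
      by (cases "u = 1") auto
  qed simp
  ultimately have "AE \<omega> in M. D 1 \<omega> = cond_exp M 1 (rect_sum D n) \<omega>"
    using n by (auto elim: eventually_mono)
  then show ?thesis
    by (rule sq_integrable_cong_AE) (use sq in \<open>auto intro: sq_integrable_cond_exp\<close>)
qed

text \<open>Connects the criterion for one function with statements about fields;
  \<open>proj_dist\<close> is unchanged by passing to an almost everywhere equal version.\<close>

lemma exists_mdiff_iff_exists_field:
  "(\<exists>V. mdiff 1 V \<and> ((\<lambda>n. rest n / vol n) \<longlongrightarrow> 0) min_at_top \<and> ((\<lambda>n. proj_dist V n / vol n) \<longlongrightarrow> 0) min_at_top) \<longleftrightarrow>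
   (\<exists>D. martingale_differences M D \<and> mdiff 1 (D 1) \<and> ((\<lambda>n. rest n / vol n) \<longlongrightarrow> 0) min_at_top \<and>
      ((\<lambda>n. proj_dist (D 1) n / vol n) \<longlongrightarrow> 0) min_at_top)"
  (is "?lhs \<longleftrightarrow> ?rhs")
proof
  assume ?lhs
  then obtain V where V: "mdiff 1 V" and lim: "((\<lambda>n. rest n / vol n) \<longlongrightarrow> 0) min_at_top"
      "((\<lambda>n. proj_dist V n / vol n) \<longlongrightarrow> 0) min_at_top" by blast
  obtain D where D: "martingale_differences M D" "AE \<omega> in M. D 1 \<omega> = V \<omega>" "mdiff 1 (D 1)"
    by (rule mdiff_extends_to_field[OF V])
  have "proj_dist (D 1) n = proj_dist V n" for n
    using D(2,3) V by (auto simp: proj_dist_def mdiff_def sq_integrable_def intro!: sum.cong msq_cong_AE)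
  then show ?rhs using lim D(1,3) by auto
qed blast

lemma martingale_approximation_iff:
  "martingale_approximation M X \<longleftrightarrow>
    (\<exists>D. mdiff 1 D \<and> ((\<lambda>n. rest n / vol n) \<longlongrightarrow> 0) min_at_top \<and> ((\<lambda>n. proj_dist D n / vol n) \<longlongrightarrow> 0) min_at_top)"
  (is "_ \<longleftrightarrow> ?rhs")
proof -
  have *: "((\<lambda>n. norm2_sq M (\<lambda>\<omega>. S n \<omega> - rect_sum D n \<omega>) / ennreal (vol n)) \<longlongrightarrow> 0) min_at_top \<longleftrightarrow>
      ((\<lambda>n. rest n / vol n) \<longlongrightarrow> 0) min_at_top \<and> ((\<lambda>n. proj_dist (D 1) n / vol n) \<longlongrightarrow> 0) min_at_top"
    if D: "martingale_differences M D" "sq_integrable M (D 1)" for D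
  proof -
    have "((\<lambda>n. norm2_sq M (\<lambda>\<omega>. S n \<omega> - rect_sum D n \<omega>) / ennreal (vol n)) \<longlongrightarrow> 0) min_at_top \<longleftrightarrow>
        ((\<lambda>n. rest n / vol n + proj_dist (D 1) n / vol n) \<longlongrightarrow> 0) min_at_top"
      unfolding norm2_sq_S_minus_rect_sum[OF D]
      using tendsto_ennreal_divide_vol_iff[of "\<lambda>n. rest n + proj_dist (D 1) n" 0]
      by (simp add: rest_nonneg proj_dist_nonneg add_divide_distrib)
    also have "\<dots> \<longleftrightarrow> ((\<lambda>n. rest n / vol n) \<longlongrightarrow> 0) min_at_top \<and> ((\<lambda>n. proj_dist (D 1) n / vol n) \<longlongrightarrow> 0) min_at_top"
      by (intro tendsto_add_nonneg_0_iff; rule eventually_mono[OF eventually_min_at_top_ge_1])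
         (auto simp: rest_nonneg proj_dist_nonneg less_imp_le[OF vol_pos])
    finally show ?thesis .
  qed
  have "martingale_approximation M X \<longleftrightarrow> (\<exists>D. martingale_differences M D \<and> mdiff 1 (D 1) \<and>
      ((\<lambda>n. rest n / vol n) \<longlongrightarrow> 0) min_at_top \<and> ((\<lambda>n. proj_dist (D 1) n / vol n) \<longlongrightarrow> 0) min_at_top)"
    unfolding martingale_approximation_def
  proof (intro iff_exI conj_cong refl)
    fix D assume D: "martingale_differences M D"
    show "((\<lambda>n. norm2_sq M (\<lambda>\<omega>. S n \<omega> - rect_sum D n \<omega>) / ennreal (vol n)) \<longlongrightarrow> 0) min_at_top \<longleftrightarrow>
      mdiff 1 (D 1) \<and> ((\<lambda>n. rest n / vol n) \<longlongrightarrow> 0) min_at_top \<and> ((\<lambda>n. proj_dist (D 1) n / vol n) \<longlongrightarrow> 0) min_at_top"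
      (is "?l \<longleftrightarrow> ?r")
    proof
      assume lim: ?l
      obtain n where "1 \<le> n" "norm2_sq M (\<lambda>\<omega>. S n \<omega> - rect_sum D n \<omega>) < \<infinity>"
        by (rule finite_norm2_sq_witness[OF lim])
      then have sq: "sq_integrable M (D 1)" by (rule sq_integrable_of_rect_sum[OF D])
      then show ?r
        using *[OF D sq] lim mdiff_martingale_differences[OF D sq] by simp
    next
      assume r: ?r
      then have "sq_integrable M (D 1)" by (auto dest: mdiff_sq_integrable)
      from *[OF D this] r show ?l by simp
    qed
  qed
  then show ?thesis unfolding exists_mdiff_iff_exists_field .
qed

text \<open>For a martingale differences field, \<open>mdiff 1 (D 1)\<close> amounts to square
  integrability, which the limit forces.\<close>

lemma altproj_dist_tendsto_iff:
  assumes D: "martingale_differences M D"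
  shows "((\<lambda>n. (\<Sum>j\<in>{1..n}. norm2_sq M (\<lambda>\<omega>. altproj M 1 (S j) \<omega> - D 1 \<omega>)) / ennreal (vol n)) \<longlongrightarrow> 0) min_at_top
    \<longleftrightarrow> mdiff 1 (D 1) \<and> ((\<lambda>n. proj_dist (D 1) n / vol n) \<longlongrightarrow> 0) min_at_top"
  (is "?l \<longleftrightarrow> ?r")
proof -
  have *: "?l \<longleftrightarrow> ((\<lambda>n. proj_dist (D 1) n / vol n) \<longlongrightarrow> 0) min_at_top" if sq: "sq_integrable M (D 1)"
  proof -
    have "norm2_sq M (\<lambda>\<omega>. altproj M 1 (S j) \<omega> - D 1 \<omega>) = ennreal (msq M (\<lambda>\<omega>. altproj M 1 (S j) \<omega> - D 1 \<omega>))" for j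
      by (intro norm2_sq_eq_msq sq_integrable_diff sq_integrable_altproj sq_integrable_S sq)
    then have "(\<Sum>j\<in>{1..n}. norm2_sq M (\<lambda>\<omega>. altproj M 1 (S j) \<omega> - D 1 \<omega>)) = ennreal (proj_dist (D 1) n)" for n
      by (simp add: proj_dist_def)
    then show ?thesis
      using tendsto_ennreal_divide_vol_iff[of "proj_dist (D 1)" 0] by (simp add: proj_dist_nonneg)
  qed
  show ?thesis
  proof
    assume lim: ?l
    obtain n :: "int ^ 'd" where n: "1 \<le> n" and
      fin: "(\<Sum>j\<in>{1..n}. norm2_sq M (\<lambda>\<omega>. altproj M 1 (S j) \<omega> - D 1 \<omega>)) < \<infinity>"
      by (rule finite_norm2_sq_witness[OF lim])
    \<comment> \<open>The point \<open>j = 1\<close> lies in the box, so a finite total bounds its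
      summand and makes \<open>D 1\<close> a difference of square integrable functions.\<close>
    have "norm2_sq M (\<lambda>\<omega>. altproj M 1 (S 1) \<omega> - D 1 \<omega>) \<le> (\<Sum>j\<in>{1..n}. norm2_sq M (\<lambda>\<omega>. altproj M 1 (S j) \<omega> - D 1 \<omega>))"
      using n by (intro member_le_sum) auto
    then have "norm2_sq M (\<lambda>\<omega>. altproj M 1 (S 1) \<omega> - D 1 \<omega>) < \<infinity>"
      using fin by (rule le_less_trans)
    then have "sq_integrable M (\<lambda>\<omega>. altproj M 1 (S 1) \<omega> - D 1 \<omega>)"
      using martingale_differences_measurable[OF D] by (simp add: sq_integrable_iff_norm2_sq)
    from sq_integrable_diff[OF sq_integrable_altproj[OF sq_integrable_S, of 1 1] this]
    have sq: "sq_integrable M (D 1)" by simp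
    show ?r using *[OF sq] lim mdiff_martingale_differences[OF D sq] by simp
  next
    assume r: ?r
    then have "sq_integrable M (D 1)" by (auto dest: mdiff_sq_integrable)
    from *[OF this] r show ?l by simp
  qed
qed

text \<open>\<open>rest n\<close> dominates each term and is dominated by a constant times their
  finite sum, so both directions are sandwich arguments.\<close>

lemma rest_tendsto_iff:
  "(\<forall>j. ((\<lambda>n. norm2_sq M (cond_exp M (zero_on {j} n) (S n)) / ennreal (vol n)) \<longlongrightarrow> 0) min_at_top)
    \<longleftrightarrow> ((\<lambda>n. rest n / vol n) \<longlongrightarrow> 0) min_at_top"
proof -
  define g where "g j n = msq M (cond_exp M (zero_on {j} n) (S n))" for j n
  have "((\<lambda>n. norm2_sq M (cond_exp M (zero_on {j} n) (S n)) / ennreal (vol n)) \<longlongrightarrow> 0) min_at_top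
      \<longleftrightarrow> ((\<lambda>n. g j n / vol n) \<longlongrightarrow> 0) min_at_top" for j
    using tendsto_ennreal_divide_vol_iff[of "g j" 0]
    by (simp add: g_def norm2_sq_eq_msq sq_integrable_cond_exp sq_integrable_S)
  moreover have "((\<lambda>n. g j n / vol n) \<longlongrightarrow> 0) min_at_top" if "((\<lambda>n. rest n / vol n) \<longlongrightarrow> 0) min_at_top" for j
    by (rule tendsto_sandwich[OF _ _ tendsto_const that]; rule eventually_mono[OF eventually_min_at_top_ge_1])
       (auto simp: g_def msq_cond_exp_le_rest less_imp_le[OF vol_pos] intro!: divide_right_mono)
  moreover have "((\<lambda>n. rest n / vol n) \<longlongrightarrow> 0) min_at_top" if "\<And>j. ((\<lambda>n. g j n / vol n) \<longlongrightarrow> 0) min_at_top"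
  proof (rule tendsto_sandwich[OF _ _ tendsto_const])
    show "((\<lambda>n. 4 ^ CARD('d) * (\<Sum>j\<in>UNIV. g j n / vol n)) \<longlongrightarrow> 0) min_at_top"
      using tendsto_mult_left[OF tendsto_sum[of UNIV "\<lambda>j n. g j n / vol n" "\<lambda>_. 0", OF that], of "4 ^ CARD('d)"]
      by simp
    show "\<forall>\<^sub>F n in min_at_top. rest n / vol n \<le> 4 ^ CARD('d) * (\<Sum>j\<in>UNIV. g j n / vol n)"
      using eventually_min_at_top_ge_1
    proof eventually_elim
      case (elim n)
      then show ?case
        using divide_right_mono[OF rest_le[OF elim], of "vol n"] vol_pos[OF elim]
        by (simp add: g_def flip: sum_divide_distrib)
    qed
    show "\<forall>\<^sub>F n in min_at_top. 0 \<le> rest n / vol n"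
      using eventually_min_at_top_ge_1
      by eventually_elim (auto simp: rest_nonneg less_imp_le[OF vol_pos])
  qed
  ultimately show ?thesis by blast
qed

lemma norm2_sq_S_tendsto_iff_msq:
  assumes "sq_integrable M D"
  shows "((\<lambda>n. norm2_sq M (S n) / ennreal (vol n)) \<longlongrightarrow> norm2_sq M D) min_at_top
    \<longleftrightarrow> ((\<lambda>n. msq M (S n) / vol n) \<longlongrightarrow> msq M D) min_at_top"
  using tendsto_ennreal_divide_vol_iff[of "\<lambda>n. msq M (S n)" "msq M D"] assms
  by (simp add: norm2_sq_eq_msq sq_integrable_S)

lemma proj_mean_tendsto:
  assumes D: "sq_integrable M D" and lim: "((\<lambda>n. proj_dist D n / vol n) \<longlongrightarrow> 0) min_at_top"
  shows "((\<lambda>n. msq M (\<lambda>\<omega>. proj_mean n \<omega> - D \<omega>)) \<longlongrightarrow> 0) min_at_top"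
  by (rule tendsto_sandwich[OF _ _ tendsto_const lim]; rule eventually_mono[OF eventually_min_at_top_ge_1])
     (auto simp: msq_proj_mean_le[OF _ D])

text \<open>Under the assumed limit the averages converge to \<open>D\<close>, so the share of
  \<open>proj_dist\<close> with zero function in \<open>msq M (S n) / vol n\<close> already tends to
  \<open>msq M D\<close>.\<close>

lemma norm2_sq_S_tendsto_iff_rest:
  assumes D: "sq_integrable M D" and lim: "((\<lambda>n. proj_dist D n / vol n) \<longlongrightarrow> 0) min_at_top"
  shows "((\<lambda>n. norm2_sq M (S n) / ennreal (vol n)) \<longlongrightarrow> norm2_sq M D) min_at_top
    \<longleftrightarrow> ((\<lambda>n. rest n / vol n) \<longlongrightarrow> 0) min_at_top"
proof -
  have A: "((\<lambda>n. \<integral>\<omega>. proj_mean n \<omega> * D \<omega> \<partial>M) \<longlongrightarrow> msq M D) min_at_top"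
    by (rule integral_mult_tendsto[OF sq_integrable_proj_mean D proj_mean_tendsto[OF D lim]])
  \<comment> \<open>For \<open>1 <= n\<close> this is
    \<open>proj_dist (\<lambda>_. 0) n / vol n\<close>, solved from
    \<open>proj_dist_eq\<close>.\<close>
  define h where "h n = proj_dist D n / vol n + 2 * (\<integral>\<omega>. proj_mean n \<omega> * D \<omega> \<partial>M) - msq M D" for n
  have h: "(h \<longlongrightarrow> msq M D) min_at_top"
    unfolding h_def using tendsto_diff[OF tendsto_add[OF lim tendsto_mult_left[OF A, of 2]] tendsto_const[of "msq M D"]]
    by simp
  have "((\<lambda>n. msq M (S n) / vol n) \<longlongrightarrow> msq M D) min_at_top \<longleftrightarrow>
      ((\<lambda>n. rest n / vol n + h n) \<longlongrightarrow> msq M D) min_at_top"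
    by (rule tendsto_cong, rule eventually_mono[OF eventually_min_at_top_ge_1])
       (simp add: h_def proj_dist_eq[OF _ D] msq_S add_divide_distrib)
  also have "\<dots> \<longleftrightarrow> ((\<lambda>n. rest n / vol n) \<longlongrightarrow> 0) min_at_top"
    using tendsto_diff[OF _ h, of "\<lambda>n. rest n / vol n + h n" "msq M D"] tendsto_add[OF _ h, of "\<lambda>n. rest n / vol n" 0]
    by auto
  finally show ?thesis unfolding norm2_sq_S_tendsto_iff_msq[OF D] .
qed

text \<open>Replacing the first term of \<open>proj_dist_eq\<close> by the larger
  \<open>msq M (S n) / vol n\<close> gives an upper bound whose limit is
  \<open>msq M D - 2 * msq M D + msq M D = 0\<close>.\<close>

lemma proj_dist_tendsto_0:
  assumes D: "sq_integrable M D"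
    and mean: "((\<lambda>n. msq M (\<lambda>\<omega>. proj_mean n \<omega> - D \<omega>)) \<longlongrightarrow> 0) min_at_top"
    and var: "((\<lambda>n. msq M (S n) / vol n) \<longlongrightarrow> msq M D) min_at_top"
  shows "((\<lambda>n. proj_dist D n / vol n) \<longlongrightarrow> 0) min_at_top"
proof (rule tendsto_sandwich[OF _ _ tendsto_const])
  show "((\<lambda>n. msq M (S n) / vol n - 2 * (\<integral>\<omega>. proj_mean n \<omega> * D \<omega> \<partial>M) + msq M D) \<longlongrightarrow> 0) min_at_top"
    using tendsto_add[OF tendsto_diff[OF var tendsto_mult_left[OF integral_mult_tendsto[OF sq_integrable_proj_mean D mean], of 2]]
      tendsto_const[of "msq M D"]]
    by simp
  show "\<forall>\<^sub>F n in min_at_top. 0 \<le> proj_dist D n / vol n"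
    using eventually_min_at_top_ge_1
    by eventually_elim (auto simp: proj_dist_nonneg less_imp_le[OF vol_pos])
  show "\<forall>\<^sub>F n in min_at_top. proj_dist D n / vol n \<le> msq M (S n) / vol n - 2 * (\<integral>\<omega>. proj_mean n \<omega> * D \<omega> \<partial>M) + msq M D"
    using eventually_min_at_top_ge_1
  proof eventually_elim
    case (elim n)
    have "proj_dist (\<lambda>_. 0) n / vol n \<le> msq M (S n) / vol n"
      using vol_pos[OF elim] rest_nonneg[of n] by (intro divide_right_mono) (simp_all add: msq_S)
    then show ?case unfolding proj_dist_eq[OF elim D] by simp
  qed
qed

text \<open>The same \<open>D\<close> witnesses both sides: forward, it inherits
  \<open>mdiff\<close> as a limit of the averages; backward, the averages converge because the mean
  squared distances do.\<close>

lemma proj_mean_criterion_iff: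
  "(\<exists>D. D \<in> borel_measurable M \<and> integrable M (\<lambda>\<omega>. (D \<omega>)\<^sup>2) \<and>
      ((\<lambda>n. norm2_sq M (\<lambda>\<omega>. proj_mean n \<omega> - D \<omega>)) \<longlongrightarrow> 0) min_at_top \<and>
      ((\<lambda>n. norm2_sq M (S n) / ennreal (vol n)) \<longlongrightarrow> norm2_sq M D) min_at_top) \<longleftrightarrow>
    (\<exists>D. mdiff 1 D \<and> ((\<lambda>n. rest n / vol n) \<longlongrightarrow> 0) min_at_top \<and> ((\<lambda>n. proj_dist D n / vol n) \<longlongrightarrow> 0) min_at_top)"
  (is "(\<exists>D. ?P D) \<longleftrightarrow> (\<exists>D. ?Q D)")
proof (rule iff_exI)
  fix D
  have mean: "((\<lambda>n. norm2_sq M (\<lambda>\<omega>. proj_mean n \<omega> - D \<omega>)) \<longlongrightarrow> 0) min_at_top \<longleftrightarrow>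
      ((\<lambda>n. msq M (\<lambda>\<omega>. proj_mean n \<omega> - D \<omega>)) \<longlongrightarrow> 0) min_at_top" if D: "sq_integrable M D"
    using tendsto_ennreal_iff[of "\<lambda>n. msq M (\<lambda>\<omega>. proj_mean n \<omega> - D \<omega>)" min_at_top 0]
    by (simp add: norm2_sq_eq_msq sq_integrable_diff sq_integrable_proj_mean D)
  show "?P D \<longleftrightarrow> ?Q D"
  proof
    assume P: "?P D"
    then have D: "sq_integrable M D" by (simp add: sq_integrable_def)
    then have lim: "((\<lambda>n. msq M (\<lambda>\<omega>. proj_mean n \<omega> - D \<omega>)) \<longlongrightarrow> 0) min_at_top"
      using P mean by blast
    have dist: "((\<lambda>n. proj_dist D n / vol n) \<longlongrightarrow> 0) min_at_top"
      using P norm2_sq_S_tendsto_iff_msq[OF D] by (intro proj_dist_tendsto_0[OF D lim]) blast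
    have "mdiff 1 D"
      by (rule mdiff_limit[OF mdiff_proj_mean D min_at_top_neq_bot lim])
    with dist P norm2_sq_S_tendsto_iff_rest[OF D dist] show "?Q D" by blast
  next
    assume Q: "?Q D"
    then have D: "sq_integrable M D" by (simp add: mdiff_def)
    with Q show "?P D"
      using mean[OF D] proj_mean_tendsto[OF D] norm2_sq_S_tendsto_iff_rest[OF D]
      by (simp add: sq_integrable_def)
  qed
qed

end

section \<open>Equivalence of the four statements through one common criterion\<close>

theorem theorem7:
  fixes M :: "('d::{finite,linorder}) config measure"
    and f :: "'d config \<Rightarrow> real"
    and X S :: "int ^ 'd::{finite,linorder} \<Rightarrow> 'd config \<Rightarrow> real"
  assumes "CARD('d) \<ge> 2"
    and "prob_space M"
    and "sets M = sets cylinder_algebra"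
    and "shift_invariant M"
    and "f \<in> past_measurable"
    and "X = past_field f"
    and "integrable M (\<lambda>\<omega>. (X 0 \<omega>)\<^sup>2)"
    and "(\<integral>\<omega>. X 0 \<omega> \<partial>M) = 0"
    and "commuting M"
    and "S = rect_sum X"
  shows
    "let
       a = martingale_approximation M X;
       b = (\<exists>D. martingale_differences M D \<and>
              ((\<lambda>n. norm2_sq M (S n) / ennreal (vol n)) \<longlongrightarrow> norm2_sq M (D 1)) min_at_top \<and>
              ((\<lambda>n. (\<Sum>j\<in>{1..n}. norm2_sq M (\<lambda>\<omega>. proj M 1 (S j) \<omega> - D 1 \<omega>)) / ennreal (vol n))
                 \<longlongrightarrow> 0) min_at_top);
       c = (\<exists>D. martingale_differences M D \<and>
              ((\<lambda>n. (\<Sum>j\<in>{1..n}. norm2_sq M (\<lambda>\<omega>. proj M 1 (S j) \<omega> - D 1 \<omega>)) / ennreal (vol n))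
                 \<longlongrightarrow> 0) min_at_top \<and>
              (\<forall>j. ((\<lambda>n. norm2_sq M (cond_exp M (\<chi> i. if i = j then 0 else n $ i) (S n))
                            / ennreal (vol n)) \<longlongrightarrow> 0) min_at_top));
       d = (\<exists>D1. D1 \<in> borel_measurable M \<and> integrable M (\<lambda>\<omega>. (D1 \<omega>)\<^sup>2) \<and>
              ((\<lambda>n. norm2_sq M (\<lambda>\<omega>. (\<Sum>j\<in>{1..n}. proj M 1 (S j) \<omega>) / vol n - D1 \<omega>))
                 \<longlongrightarrow> 0) min_at_top \<and>
              ((\<lambda>n. norm2_sq M (S n) / ennreal (vol n)) \<longlongrightarrow> norm2_sq M D1) min_at_top)
     in (a \<longleftrightarrow> b) \<and> (b \<longleftrightarrow> c) \<and> (c \<longleftrightarrow> d)"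
proof -
  interpret commuting_field M
    by (intro commuting_field.intro commuting_field_axioms.intro assms)
  have "sq_integrable M (past_field f 0)"
    using assms(7) past_field_measurable_M[OF assms(5)] by (simp add: sq_integrable_def assms(6))
  then interpret stationary_field M f
    by unfold_locales (rule assms(5))
  have S: "S = rect_sum (past_field f)"
    by (simp add: assms)
  \<comment> \<open>The sorted list of the index type lists every coordinate exactly once, so the
    composition agrees almost everywhere with its inclusion-exclusion form, and the norms do not see
    the difference.\<close>
  have proj: "AE \<omega> in M. proj M 1 (S j) \<omega> = altproj M 1 (S j) \<omega>" for j
    unfolding proj_def S by (rule proj_eq_altproj[OF integrable_S]) auto
  have dist: "norm2_sq M (\<lambda>\<omega>. proj M 1 (S j) \<omega> - D \<omega>) = norm2_sq M (\<lambda>\<omega>. altproj M 1 (S j) \<omega> - D \<omega>)" for j D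
    using proj[of j] by (intro norm2_sq_cong_AE) (auto elim: eventually_mono)
  have mean: "norm2_sq M (\<lambda>\<omega>. (\<Sum>j\<in>{1..n}. proj M 1 (S j) \<omega>) / vol n - D \<omega>) = norm2_sq M (\<lambda>\<omega>. proj_mean n \<omega> - D \<omega>)" for n D
  proof -
    have "AE \<omega> in M. (\<Sum>j\<in>{1..n}. proj M 1 (S j) \<omega>) = (\<Sum>j\<in>{1..n}. altproj M 1 (S j) \<omega>)"
      by (intro AE_sum_cong proj) simp
    then show ?thesis
      unfolding proj_mean_def S by (intro norm2_sq_cong_AE) (auto elim: eventually_mono)
  qed
  have zero: "(\<chi> i. if i = j then 0 else n $ i) = zero_on {j} n" for j :: 'd and n :: "(int, 'd) vec"
    by (simp add: vec_eq_iff)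
  \<comment> \<open>The common criterion to which each of the four statements is shown
    equivalent.\<close>
  let ?Q = "\<exists>D. mdiff 1 D \<and> ((\<lambda>n. rest n / vol n) \<longlongrightarrow> 0) min_at_top \<and> ((\<lambda>n. proj_dist D n / vol n) \<longlongrightarrow> 0) min_at_top"
  have a: "martingale_approximation M X \<longleftrightarrow> ?Q"
    unfolding assms(6) by (rule martingale_approximation_iff)
  have b: "(\<exists>D. martingale_differences M D \<and>
              ((\<lambda>n. norm2_sq M (S n) / ennreal (vol n)) \<longlongrightarrow> norm2_sq M (D 1)) min_at_top \<and>
              ((\<lambda>n. (\<Sum>j\<in>{1..n}. norm2_sq M (\<lambda>\<omega>. proj M 1 (S j) \<omega> - D 1 \<omega>)) / ennreal (vol n))
                 \<longlongrightarrow> 0) min_at_top) \<longleftrightarrow> ?Q"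
    unfolding exists_mdiff_iff_exists_field dist unfolding S
    using altproj_dist_tendsto_iff norm2_sq_S_tendsto_iff_rest mdiff_sq_integrable
    by (intro iff_exI) blast
  have c: "(\<exists>D. martingale_differences M D \<and>
              ((\<lambda>n. (\<Sum>j\<in>{1..n}. norm2_sq M (\<lambda>\<omega>. proj M 1 (S j) \<omega> - D 1 \<omega>)) / ennreal (vol n))
                 \<longlongrightarrow> 0) min_at_top \<and>
              (\<forall>j. ((\<lambda>n. norm2_sq M (cond_exp M (\<chi> i. if i = j then 0 else n $ i) (S n))
                            / ennreal (vol n)) \<longlongrightarrow> 0) min_at_top)) \<longleftrightarrow> ?Q"
    unfolding exists_mdiff_iff_exists_field dist zero unfolding S rest_tendsto_iff
    using altproj_dist_tendsto_iff by (intro iff_exI) blast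
  have d: "(\<exists>D1. D1 \<in> borel_measurable M \<and> integrable M (\<lambda>\<omega>. (D1 \<omega>)\<^sup>2) \<and>
              ((\<lambda>n. norm2_sq M (\<lambda>\<omega>. (\<Sum>j\<in>{1..n}. proj M 1 (S j) \<omega>) / vol n - D1 \<omega>))
                 \<longlongrightarrow> 0) min_at_top \<and>
              ((\<lambda>n. norm2_sq M (S n) / ennreal (vol n)) \<longlongrightarrow> norm2_sq M D1) min_at_top) \<longleftrightarrow> ?Q"
    unfolding mean unfolding S by (rule proj_mean_criterion_iff)
  show ?thesis
    unfolding Let_def a b c d by simp
qed

end
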